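(* Let $n\geq 2$ be an integer and $a>0$. Let $g$ be the Kähler metric on $\mathbb{C}^n\setminus\{0\}$ given in the standard coordinates by $$g_{\mu\bar\nu}=\sqrt[n]{1+\frac{a^n}{u^n}}\left(\delta_{\mu\bar\nu}-\frac{a^n}{a^n+u^n}\frac{\bar z_\mu z_\nu}{u}\right),\qquad u=|z|^2_{\mathbb{C}^n}.$$ Then the Christoffel symbols of $g$ are $$\Gamma^\lambda_{\mu\alpha}=-\frac{a^n}{u(a^n+u^n)}\left(\bar z_\mu\delta^\lambda{}_\alpha+\bar z_\alpha\delta^\lambda{}_\mu-(n+1)\frac{\bar z_\alpha\bar z_\mu}{u}z^\lambda\right).$$ The curvature tensor of $g$ is $$\begin{aligned} R_{\mu\bar\nu\alpha\bar\beta}=\frac{a^n}{(a^n+u^n)^{\frac{n+1}{n}}}\Bigg(&g_{\alpha\bar\nu}g_{\mu\bar\beta}+g_{\mu\bar\nu}g_{\alpha\bar\beta}\\ &-(n+1)\left(\frac{u}{\sqrt[n]{a^n+u^n}}\right)^{n-1}\left(\frac{\bar z_\mu z_\beta}{u}g_{\alpha\bar\nu}+\frac{\bar z_\alpha z_\beta}{u}g_{\mu\bar\nu}+\frac{\bar z_\mu z_\nu}{u}g_{\alpha\bar\beta}+\frac{\bar z_\alpha z_\nu}{u}g_{\mu\bar\beta}\right)\\ &+(n+1)(n+2)\left(\frac{u}{\sqrt[n]{a^n+u^n}}\right)^{2n-2}\frac{\bar z_\mu z_\nu\bar z_\alpha z_\beta}{u^2}\Bigg). \end{aligned}$$ The Kretschmann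 scalar is $$K(z):=R_{\mu\bar\nu\alpha\bar\beta}R^{\bar\mu\nu\bar\alpha\beta}(z)=\frac{a^{2n}}{(a^n+u^n)^{2\left(\frac{n+1}{n}\right)}}\,n(n+2)(n^2-1),$$ which for $n=2$ reads $K(z)=\dfrac{24a^4}{(a^2+u^2)^3}$.
   Context: Complex tensor notation for Kähler metrics is used, with the summation convention; Greek indices run over $1,\dots,n$. Indices on $z$ and $\bar z$ are raised and lowered with the Euclidean metric, so $z_\nu=z^\nu$ and $\bar z_\mu=\bar z^\mu$ numerically. The inverse metric satisfies $g_{\mu\bar\nu}g^{\bar\nu\lambda}=\delta_\mu{}^\lambda$. The Christoffel symbols of a Kähler metric are $\Gamma^\lambda_{\mu\alpha}=(\partial_{z^\alpha} g_{\mu\bar\nu})\,g^{\bar\nu\lambda}$ (and their conjugates; mixed ones vanish). The curvature convention is $R^\lambda{}_{\mu\bar\beta\alpha}=-\partial\Gamma^\lambda_{\mu\alpha}/\partial\bar z^\beta$ and $R_{\mu\bar\nu\alpha\bar\beta}=R_{\bar\nu\mu\bar\beta\alpha}=g_{\lambda\bar\nu}R^\lambda{}_{\mu\bar\beta\alpha}$. In $K$, the indices of $R$ are raised with the inverse of $g$, i.e. $K=R_{\mu\bar\nu\alpha\bar\beta}\,\overline{R_{\mu'\bar\nu'\alpha'\bar\beta'}}\,g^{\bar\mu'\mu}g^{\bar\nu\nu'}g^{\bar\alpha'\alpha}g^{\bar\beta\beta'}$, summed over all indices from $1$ to $n$ (only components of the displayed type are summed). *)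

theory Defs
  imports "HOL-Analysis.Analysis"
begin

text \<open>
  Functions on \<open>\<complex>\<^sup>n\<close> are functions on the type \<^typ>\<open>complex ^ 'n\<close>, with \<open>n = CARD('n)\<close>.
  Differentiability is meant over \<^typ>\<open>real\<close> throughout; \<open>axis \<alpha> 1\<close> and \<open>axis \<alpha> \<i>\<close> are the
  coordinate vectors of \<open>x\<^sup>\<alpha>\<close> and \<open>y\<^sup>\<alpha>\<close> where \<open>z\<^sup>\<alpha> = x\<^sup>\<alpha> + \<i> y\<^sup>\<alpha>\<close>.
\<close>

definition d_z :: "'n::finite \<Rightarrow> (complex ^ 'n \<Rightarrow> complex) \<Rightarrow> complex ^ 'n \<Rightarrow> complex" where
  "d_z \<alpha> f z =
     (frechet_derivative f (at z) (axis \<alpha> 1) - \<i> * frechet_derivative f (at z) (axis \<alpha> \<i>)) / 2"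

definition d_zbar :: "'n::finite \<Rightarrow> (complex ^ 'n \<Rightarrow> complex) \<Rightarrow> complex ^ 'n \<Rightarrow> complex" where
  "d_zbar \<alpha> f z =
     (frechet_derivative f (at z) (axis \<alpha> 1) + \<i> * frechet_derivative f (at z) (axis \<alpha> \<i>)) / 2"

text \<open>\<open>k\<close> times continuously differentiable; meaningful for open \<open>S\<close> only.\<close>

primrec Ck_on :: "nat \<Rightarrow> 'a::euclidean_space set \<Rightarrow> ('a \<Rightarrow> 'b::real_normed_vector) \<Rightarrow> bool" where
  "Ck_on 0 S f \<longleftrightarrow> continuous_on S f"
| "Ck_on (Suc k) S f \<longleftrightarrow>
     (\<forall>x\<in>S. f differentiable (at x)) \<and>
     (\<forall>v. Ck_on k S (\<lambda>x. frechet_derivative f (at x) v))"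

definition smooth_on :: "'a::euclidean_space set \<Rightarrow> ('a \<Rightarrow> 'b::real_normed_vector) \<Rightarrow> bool" where
  "smooth_on S f \<longleftrightarrow> (\<forall>k. Ck_on k S f)"

text \<open>
  A metric is given by its matrix of components: \<open>g z $ \<mu> $ \<nu>\<close> is \<open>g\<^sub>\<mu>\<^sub>\<nu>\<close> at \<open>z\<close> with \<open>\<mu>\<close> the
  unbarred and \<open>\<nu>\<close> the barred index. The last condition is the vanishing of the (2,1)-part of
  \<open>d\<omega>\<close>, where \<open>\<omega> = \<i> g\<^sub>\<mu>\<^sub>\<nu> dz\<^sup>\<mu> \<and> d(cnj z\<^sup>\<nu>)\<close>; the (1,2)-part is its conjugate.
\<close>

definition kahler_metric_on ::
    "(complex ^ 'n) set \<Rightarrow> (complex ^ 'n \<Rightarrow> complex ^ 'n ^ 'n::finite) \<Rightarrow> bool" where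
  "kahler_metric_on S g \<longleftrightarrow>
     open S \<and>
     (\<forall>\<mu> \<nu>. smooth_on S (\<lambda>z. g z $ \<mu> $ \<nu>)) \<and>
     (\<forall>z\<in>S. \<forall>\<mu> \<nu>. g z $ \<nu> $ \<mu> = cnj (g z $ \<mu> $ \<nu>)) \<and>
     (\<forall>z\<in>S. \<forall>v. v \<noteq> 0 \<longrightarrow> 0 < Re (\<Sum>\<mu>\<in>UNIV. \<Sum>\<nu>\<in>UNIV. g z $ \<mu> $ \<nu> * v $ \<mu> * cnj (v $ \<nu>))) \<and>
     (\<forall>z\<in>S. \<forall>\<alpha> \<mu> \<nu>. d_z \<alpha> (\<lambda>w. g w $ \<mu> $ \<nu>) z = d_z \<mu> (\<lambda>w. g w $ \<alpha> $ \<nu>) z)"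

text \<open>
  In the inverse matrix the row index is the barred one, so \<open>g_inv g z \<nu> \<kappa>\<close> is the component
  with barred \<open>\<nu>\<close> and unbarred \<open>\<kappa>\<close>.
\<close>

definition g_inv :: "(complex ^ 'n \<Rightarrow> complex ^ 'n ^ 'n::finite) \<Rightarrow> complex ^ 'n \<Rightarrow> 'n \<Rightarrow> 'n \<Rightarrow> complex"
  where "g_inv g z \<nu> \<kappa> = matrix_inv (g z) $ \<nu> $ \<kappa>"

text \<open>\<open>christoffel g z \<kappa> \<mu> \<alpha>\<close>: upper index \<open>\<kappa>\<close>, lower indices \<open>\<mu>\<close>, \<open>\<alpha>\<close>.\<close>

definition christoffel ::
    "(complex ^ 'n \<Rightarrow> complex ^ 'n ^ 'n::finite) \<Rightarrow> complex ^ 'n \<Rightarrow> 'n \<Rightarrow> 'n \<Rightarrow> 'n \<Rightarrow> complex" where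
  "christoffel g z \<kappa> \<mu> \<alpha> =
     (\<Sum>\<nu>\<in>UNIV. d_z \<alpha> (\<lambda>w. g w $ \<mu> $ \<nu>) z * g_inv g z \<nu> \<kappa>)"

text \<open>\<open>curvature_up g z \<kappa> \<mu> \<beta> \<alpha>\<close>: upper index \<open>\<kappa>\<close>, lower indices \<open>\<mu>\<close>, barred \<open>\<beta>\<close>, \<open>\<alpha>\<close>.\<close>

definition curvature_up ::
    "(complex ^ 'n \<Rightarrow> complex ^ 'n ^ 'n::finite) \<Rightarrow> complex ^ 'n \<Rightarrow> 'n \<Rightarrow> 'n \<Rightarrow> 'n \<Rightarrow> 'n \<Rightarrow> complex"
  where
  "curvature_up g z \<kappa> \<mu> \<beta> \<alpha> = - d_zbar \<beta> (\<lambda>w. christoffel g w \<kappa> \<mu> \<alpha>) z"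

text \<open>\<open>curvature g z \<mu> \<nu> \<alpha> \<beta>\<close>: second and fourth index barred.\<close>

definition curvature ::
    "(complex ^ 'n \<Rightarrow> complex ^ 'n ^ 'n::finite) \<Rightarrow> complex ^ 'n \<Rightarrow> 'n \<Rightarrow> 'n \<Rightarrow> 'n \<Rightarrow> 'n \<Rightarrow> complex"
  where
  "curvature g z \<mu> \<nu> \<alpha> \<beta> = (\<Sum>\<kappa>\<in>UNIV. g z $ \<kappa> $ \<nu> * curvature_up g z \<kappa> \<mu> \<beta> \<alpha>)"

definition kretschmann ::
    "(complex ^ 'n \<Rightarrow> complex ^ 'n ^ 'n::finite) \<Rightarrow> complex ^ 'n \<Rightarrow> complex" where
  "kretschmann g z =
     (\<Sum>\<mu>\<in>UNIV. \<Sum>\<nu>\<in>UNIV. \<Sum>\<alpha>\<in>UNIV. \<Sum>\<beta>\<in>UNIV.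
      \<Sum>\<mu>'\<in>UNIV. \<Sum>\<nu>'\<in>UNIV. \<Sum>\<alpha>'\<in>UNIV. \<Sum>\<beta>'\<in>UNIV.
        curvature g z \<mu> \<nu> \<alpha> \<beta> * cnj (curvature g z \<mu>' \<nu>' \<alpha>' \<beta>') *
        g_inv g z \<mu>' \<mu> * g_inv g z \<nu> \<nu>' * g_inv g z \<alpha>' \<alpha> * g_inv g z \<beta> \<beta>')"

definition delta :: "'n \<Rightarrow> 'n \<Rightarrow> complex" where
  "delta i j = (if i = j then 1 else 0)"

end

theory Submission
  imports Defs
begin

text \<open>
  The metric is \<open>F(u) \<delta>\<^sub>\<mu>\<^sub>\<nu> + F'(u) cnj z\<^sub>\<mu> z\<^sub>\<nu>\<close> with \<open>F(u) = root n (1 + a\<^sup>n / u\<^sup>n)\<close>, a rank-one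
  perturbation of a multiple of the identity; it is inverted explicitly, and Christoffel symbols
  and curvature follow from the product rule together with \<open>F' = F p\<close>,
  \<open>p = - a\<^sup>n / (u (a\<^sup>n + u\<^sup>n))\<close>.

  For the Kretschmann scalar, raise the barred indices: the curvature becomes a multiple of an
  operator on \<open>V \<otimes> V\<close>, namely of
  \<open>(1 + swap) (H \<otimes> H - n (H \<otimes> E + E \<otimes> H) + n (n - 1) / 2 E \<otimes> E)\<close>, where \<open>E\<close> is the Euclidean
  projection onto the line of \<open>z\<close> and \<open>H = 1 - E\<close>. The scalar is the trace of its square, which
  \<open>tr E = 1\<close> and \<open>tr H = n - 1\<close> determine.
\<close>

subsection \<open>Differentiability classes\<close>

text \<open>The shape of the metric is that of a potential \<phi>(u) with
  \<open>\<phi>' = F\<close>: its complex Hessian has \<open>F\<close> on the identity and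
  \<open>F'\<close> on the rank-one part, so closedness is built in. The direction of z has
  eigenvalue \<open>w = F + u F'\<close>, and w is exactly the factor
  \<open>(u / root n (a ^ n + u ^ n)) ^ (n - 1)\<close> of the curvature formula. Hence
  \<open>det g = F ^ (n - 1) * w = 1\<close> and the metric is Ricci-flat; for \<open>n = 2\<close>
  it is the Eguchi-Hanson metric, lifted to the punctured plane. This is where \<open>- n\<close>
  and \<open>n (n - 1) / 2\<close> come from: the partial trace of \<open>(1 + swap) (H \<otimes> H
  + q (H \<otimes> E + E \<otimes> H) + r E \<otimes> E)\<close> is
  \<open>(n + q) H + ((n - 1) q + 2 r) E\<close>, which vanishes for these values only. The proof
  itself finds them by splitting g into its parts along and across the line of z. The metric is
  prescribed off the origin only, and \<open>frechet_derivative\<close> and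
  \<open>matrix_inv\<close> are choice operators. Each derivative therefore comes with
  differentiability and with equality on an open set, and the inverse with a uniqueness
  argument.\<close>

lemma Ck_on_Suc_D: "Ck_on (Suc k) S f \<Longrightarrow> Ck_on k S f"
proof (induction k arbitrary: f)
  case 0
  then show ?case
    by (auto intro!: continuous_at_imp_continuous_on differentiable_imp_continuous_within)
qed auto

text \<open>On an open set equal functions have equal derivatives, so the induction can pass to the
  directional derivatives. It allows a function given off the origin to be replaced by a formula
  that holds only there.\<close>

lemma Ck_on_cong:
  assumes "open S" "\<And>x. x \<in> S \<Longrightarrow> f x = g x" "Ck_on k S f"
  shows "Ck_on k S g"
  using assms(2,3)
proof (induction k arbitrary: f g)
  case 0
  then show ?case by (simp cong: continuous_on_cong)
next
  case (Suc k)
  have D: "(g has_derivative frechet_derivative f (at x)) (at x)" if "x \<in> S" for x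
  proof (rule has_derivative_transform_within_open[OF _ assms(1) that])
    show "(f has_derivative frechet_derivative f (at x)) (at x)"
      using Suc.prems that frechet_derivative_works by auto
  qed (use Suc.prems in auto)
  then have "frechet_derivative f (at x) = frechet_derivative g (at x)" if "x \<in> S" for x
    using that frechet_derivative_at by metis
  then have "Ck_on k S (\<lambda>x. frechet_derivative g (at x) v)" for v
    using Suc.IH[of "\<lambda>x. frechet_derivative f (at x) v"] Suc.prems by auto
  with D show ?case by (auto simp: differentiable_def)
qed

text \<open>An explicit derivative \<open>D\<close> takes the place of
  \<open>frechet_derivative\<close>, so the closure properties below reduce to the usual
  differentiation rules.\<close>

lemma Ck_on_SucI:
  assumes "open S" "\<And>x. x \<in> S \<Longrightarrow> (f has_derivative D x) (at x)" "\<And>v. Ck_on k S (\<lambda>x. D x v)"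
  shows "Ck_on (Suc k) S f"
proof -
  have "Ck_on k S (\<lambda>x. frechet_derivative f (at x) v)" for v
    using assms(2)[THEN frechet_derivative_at] by (intro Ck_on_cong[OF assms(1) _ assms(3)]) simp
  then show ?thesis using assms(2) by (auto simp: differentiable_def)
qed

lemma Ck_on_has_derivative:
  "Ck_on (Suc k) S f \<Longrightarrow> x \<in> S \<Longrightarrow> (f has_derivative frechet_derivative f (at x)) (at x)"
  using frechet_derivative_works by auto

lemma Ck_on_const: "open S \<Longrightarrow> Ck_on k S (\<lambda>x. c)"
proof (induction k arbitrary: c)
  case (Suc k)
  show ?case
    by (rule Ck_on_SucI[where D = "\<lambda>x v. 0"]) (simp_all only: Suc has_derivative_const)
qed (simp add: continuous_on_const)

lemma Ck_on_add: "open S \<Longrightarrow> Ck_on k S f \<Longrightarrow> Ck_on k S g \<Longrightarrow> Ck_on k S (\<lambda>x. f x + g x)"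
proof (induction k arbitrary: f g)
  case (Suc k)
  show ?case
  proof (rule Ck_on_SucI[OF Suc.prems(1)])
    show "((\<lambda>x. f x + g x) has_derivative
        (\<lambda>v. frechet_derivative f (at x) v + frechet_derivative g (at x) v)) (at x)" if "x \<in> S" for x
      using Suc.prems that by (intro has_derivative_add Ck_on_has_derivative)
    show "Ck_on k S (\<lambda>x. frechet_derivative f (at x) v + frechet_derivative g (at x) v)" for v
      using Suc by auto
  qed
qed (auto intro: continuous_intros)

lemma Ck_on_linear:
  assumes "bounded_linear h" "open S"
  shows "Ck_on k S f \<Longrightarrow> Ck_on k S (\<lambda>x. h (f x))"
proof (induction k arbitrary: f)
  case 0
  then show ?case by (auto intro: bounded_linear.continuous_on[OF assms(1)])
next
  case (Suc k)
  show ?case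
  proof (rule Ck_on_SucI[OF assms(2)])
    show "((\<lambda>x. h (f x)) has_derivative (\<lambda>v. h (frechet_derivative f (at x) v))) (at x)"
      if "x \<in> S" for x
      using Suc.prems that by (intro bounded_linear.has_derivative[OF assms(1)] Ck_on_has_derivative)
  qed (use Suc in auto)
qed

lemma Ck_on_id: "open S \<Longrightarrow> Ck_on k S (\<lambda>x. x)"
proof (cases k)
  case (Suc m)
  assume "open S"
  then show ?thesis unfolding Suc
    by (rule Ck_on_SucI[where D = "\<lambda>x v. v"]) (simp_all only: \<open>open S\<close> Ck_on_const has_derivative_ident)
qed (simp add: continuous_on_id)

text \<open>One induction serves real and complex products as well as \<open>inner\<close>. The
  product rule leaves one factor undifferentiated, which is why \<open>Ck_on_Suc_D\<close> is called
  for.\<close>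

lemma Ck_on_bilinear:
  assumes "bounded_bilinear h" "open S"
  shows "Ck_on k S f \<Longrightarrow> Ck_on k S g \<Longrightarrow> Ck_on k S (\<lambda>x. h (f x) (g x))"
proof (induction k arbitrary: f g)
  case 0
  then show ?case by (auto intro: bounded_bilinear.continuous_on[OF assms(1)])
next
  case (Suc k)
  show ?case
  proof (rule Ck_on_SucI[OF assms(2)])
    show "((\<lambda>x. h (f x) (g x)) has_derivative (\<lambda>v. h (f x) (frechet_derivative g (at x) v) +
        h (frechet_derivative f (at x) v) (g x))) (at x)"
      if "x \<in> S" for x
      using Suc.prems that by (intro bounded_bilinear.FDERIV[OF assms(1)] Ck_on_has_derivative)
    show "Ck_on k S (\<lambda>x. h (f x) (frechet_derivative g (at x) v) +
        h (frechet_derivative f (at x) v) (g x))" for v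
      using Suc.prems by (intro Ck_on_add assms Suc.IH) (auto simp: Ck_on_Suc_D)
  qed
qed

text \<open>The derivative contains the power \<open>c - 1\<close>, so the exponent is generalized
  in the induction. Real exponents treat roots, reciprocals and integer powers of a positive
  function alike.\<close>

lemma Ck_on_powr:
  fixes f :: "'a::euclidean_space \<Rightarrow> real"
  assumes "open S" "\<And>x. x \<in> S \<Longrightarrow> 0 < f x"
  shows "Ck_on k S f \<Longrightarrow> Ck_on k S (\<lambda>x. f x powr c)"
proof (induction k arbitrary: c)
  case 0
  then show ?case using assms(2) by (auto intro!: continuous_intros) (metis less_irrefl)
next
  case (Suc k)
  show ?case
  proof (rule Ck_on_SucI[OF assms(1)])
    show "((\<lambda>x. f x powr c) has_derivative
        (\<lambda>v. (c * f x powr (c - 1)) * frechet_derivative f (at x) v)) (at x)" if "x \<in> S" for x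
    proof -
      have "((\<lambda>y. y powr c) has_derivative (\<lambda>v. (c * f x powr (c - 1)) * v)) (at (f x))"
        using has_real_derivative_powr[of "f x" c] assms(2)[OF that]
        by (simp add: has_field_derivative_def)
      from has_derivative_compose[OF Ck_on_has_derivative[OF Suc.prems that] this] show ?thesis .
    qed
    show "Ck_on k S (\<lambda>x. (c * f x powr (c - 1)) * frechet_derivative f (at x) v)" for v
      using Suc by (intro Ck_on_bilinear[OF bounded_bilinear_mult assms(1)] Ck_on_const assms(1))
        (auto simp: Ck_on_Suc_D)
  qed
qed

subsection \<open>Wirtinger derivatives\<close>

text \<open>Differentiability is part of the relation because \<open>d_z\<close> and
  \<open>d_zbar\<close> carry no information without it. With both values recorded, the rules below
  compose by resolution and compute derivatives of whole expressions.\<close>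

definition wirtinger ::
    "'n::finite \<Rightarrow> (complex ^ 'n \<Rightarrow> complex) \<Rightarrow> complex ^ 'n \<Rightarrow> complex \<Rightarrow> complex \<Rightarrow> bool" where
  "wirtinger \<alpha> f z p q \<longleftrightarrow> f differentiable (at z) \<and> d_z \<alpha> f z = p \<and> d_zbar \<alpha> f z = q"

lemma wirtingerI:
  assumes "(f has_derivative D) (at z)"
    and "p = (D (axis \<alpha> 1) - \<i> * D (axis \<alpha> \<i>)) / 2" "q = (D (axis \<alpha> 1) + \<i> * D (axis \<alpha> \<i>)) / 2"
  shows "wirtinger \<alpha> f z p q"
  using assms frechet_derivative_at[OF assms(1)]
  by (auto simp: wirtinger_def d_z_def d_zbar_def differentiable_def)

lemma wirtingerE:
  assumes "wirtinger \<alpha> f z p q"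
  obtains D where "(f has_derivative D) (at z)"
    "p = (D (axis \<alpha> 1) - \<i> * D (axis \<alpha> \<i>)) / 2" "q = (D (axis \<alpha> 1) + \<i> * D (axis \<alpha> \<i>)) / 2"
  using assms frechet_derivative_works unfolding wirtinger_def d_z_def d_zbar_def by blast

lemma wirtinger_const: "wirtinger \<alpha> (\<lambda>z. c) z 0 0"
  by (rule wirtingerI[where D = "\<lambda>v. 0"]) auto

lemma wirtinger_coord: "wirtinger \<alpha> (\<lambda>z. z $ \<mu>) z (delta \<alpha> \<mu>) 0"
  by (rule wirtingerI[where D = "\<lambda>v. v $ \<mu>"])
    (auto intro: bounded_linear_imp_has_derivative bounded_linear_vec_nth simp: delta_def axis_def)

lemma wirtinger_cnj_coord: "wirtinger \<alpha> (\<lambda>z. cnj (z $ \<mu>)) z 0 (delta \<alpha> \<mu>)"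
  by (rule wirtingerI[where D = "\<lambda>v. cnj (v $ \<mu>)"])
    (auto intro!: bounded_linear_imp_has_derivative
      bounded_linear_compose[OF bounded_linear_cnj bounded_linear_vec_nth]
      simp: delta_def axis_def)

lemma wirtinger_add:
  assumes "wirtinger \<alpha> f z p q" "wirtinger \<alpha> g z p' q'"
  shows "wirtinger \<alpha> (\<lambda>z. f z + g z) z (p + p') (q + q')"
proof -
  from assms(1) obtain D where D: "(f has_derivative D) (at z)"
    "p = (D (axis \<alpha> 1) - \<i> * D (axis \<alpha> \<i>)) / 2" "q = (D (axis \<alpha> 1) + \<i> * D (axis \<alpha> \<i>)) / 2"
    by (rule wirtingerE)
  from assms(2) obtain E where E: "(g has_derivative E) (at z)"
    "p' = (E (axis \<alpha> 1) - \<i> * E (axis \<alpha> \<i>)) / 2" "q' = (E (axis \<alpha> 1) + \<i> * E (axis \<alpha> \<i>)) / 2"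
    by (rule wirtingerE)
  show ?thesis
    by (rule wirtingerI[OF has_derivative_add[OF D(1) E(1)]])
      (simp_all add: D(2,3) E(2,3) field_simps)
qed

lemma wirtinger_mult:
  assumes "wirtinger \<alpha> f z p q" "wirtinger \<alpha> g z p' q'"
  shows "wirtinger \<alpha> (\<lambda>z. f z * g z) z (f z * p' + p * g z) (f z * q' + q * g z)"
proof -
  from assms(1) obtain D where D: "(f has_derivative D) (at z)"
    "p = (D (axis \<alpha> 1) - \<i> * D (axis \<alpha> \<i>)) / 2" "q = (D (axis \<alpha> 1) + \<i> * D (axis \<alpha> \<i>)) / 2"
    by (rule wirtingerE)
  from assms(2) obtain E where E: "(g has_derivative E) (at z)"
    "p' = (E (axis \<alpha> 1) - \<i> * E (axis \<alpha> \<i>)) / 2" "q' = (E (axis \<alpha> 1) + \<i> * E (axis \<alpha> \<i>)) / 2"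
    by (rule wirtingerE)
  show ?thesis
    by (rule wirtingerI[OF has_derivative_mult[OF D(1) E(1)]])
      (simp_all add: D(2,3) E(2,3) field_simps)
qed

text \<open>Chain rule with u = |z|^2: the real derivative \<open>2 * inner z v\<close> is twice the
  real part of \<open>z $ \<alpha>\<close> on \<open>axis \<alpha> 1\<close> and twice its imaginary
  part on \<open>axis \<alpha> \<i>\<close>, so u has Wirtinger derivatives
  \<open>cnj (z $ \<alpha>)\<close> and \<open>z $ \<alpha>\<close>.\<close>

lemma wirtinger_radial:
  assumes "(\<phi> has_real_derivative d) (at ((norm z)\<^sup>2))"
  shows "wirtinger \<alpha> (\<lambda>w. of_real (\<phi> ((norm w)\<^sup>2))) z (of_real d * cnj (z $ \<alpha>)) (of_real d * z $ \<alpha>)"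
proof -
  have 1: "((\<lambda>w. (norm w)\<^sup>2) has_derivative (\<lambda>v. 2 * inner z v)) (at z)"
    unfolding power2_norm_eq_inner
    by (auto intro!: derivative_eq_intros simp: inner_commute)
  have 2: "(\<phi> has_derivative (\<lambda>v. d * v)) (at ((norm z)\<^sup>2))"
    using assms by (simp add: has_field_derivative_def)
  have "((\<lambda>w. of_real (\<phi> ((norm w)\<^sup>2))) has_derivative (\<lambda>v. of_real (d * (2 * inner z v)))) (at z)"
    by (rule has_derivative_of_real[OF has_derivative_compose[OF 1 2]])
  then show ?thesis
    by (rule wirtingerI) (auto simp: inner_axis complex_eq_iff)
qed

lemma wirtinger_cong:
  assumes "wirtinger \<alpha> f z p q" "open S" "z \<in> S" "\<And>x. x \<in> S \<Longrightarrow> f x = g x"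
  shows "wirtinger \<alpha> g z p q"
  by (rule wirtingerE[OF assms(1)], rule wirtingerI)
    (auto intro: has_derivative_transform_within_open[OF _ assms(2,3,4)])

subsection \<open>Metrics with a radial potential\<close>

lemma sum_delta:
  fixes x :: "'n::finite \<Rightarrow> complex"
  shows "(\<Sum>\<nu>\<in>UNIV. delta \<mu> \<nu> * x \<nu>) = x \<mu>" "(\<Sum>\<nu>\<in>UNIV. delta \<nu> \<mu> * x \<nu>) = x \<mu>"
    "(\<Sum>\<nu>\<in>UNIV. x \<nu> * delta \<mu> \<nu>) = x \<mu>" "(\<Sum>\<nu>\<in>UNIV. x \<nu> * delta \<nu> \<mu>) = x \<mu>"
proof -
  have "delta \<mu> \<nu> * x \<nu> = (if \<nu> = \<mu> then x \<nu> else 0)" for \<nu> by (simp add: delta_def)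
  moreover have "delta \<nu> \<mu> = delta \<mu> \<nu>" for \<nu> :: 'n by (auto simp: delta_def)
  ultimately show "(\<Sum>\<nu>\<in>UNIV. delta \<mu> \<nu> * x \<nu>) = x \<mu>" "(\<Sum>\<nu>\<in>UNIV. delta \<nu> \<mu> * x \<nu>) = x \<mu>"
    "(\<Sum>\<nu>\<in>UNIV. x \<nu> * delta \<mu> \<nu>) = x \<mu>" "(\<Sum>\<nu>\<in>UNIV. x \<nu> * delta \<nu> \<mu>) = x \<mu>"
    by (simp_all add: mult.commute)
qed

lemma delta_commute: "delta i j = delta j i" by (auto simp: delta_def)

lemma sum_vec_mult_cnj:
  fixes z :: "complex ^ 'n::finite"
  shows "(\<Sum>\<nu>\<in>UNIV. z $ \<nu> * cnj (z $ \<nu>)) = of_real ((norm z)\<^sup>2)"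
proof -
  have "(norm z)\<^sup>2 = (\<Sum>\<nu>\<in>UNIV. (cmod (z $ \<nu>))\<^sup>2)"
    by (simp add: norm_vec_def L2_set_def sum_nonneg)
  then show ?thesis by (simp only: of_real_sum complex_norm_square)
qed

text \<open>\<open>matrix_inv\<close> selects some two-sided inverse. For square matrices over a
  field a right inverse is also a left one, so the selection has a candidate and no freedom.\<close>

lemma matrix_inv_unique:
  fixes A B :: "'a::field ^ 'n ^ 'n"
  assumes "A ** B = mat 1"
  shows "matrix_inv A = B"
proof -
  have "B ** A = mat 1" using assms matrix_left_right_inverse by blast
  with assms have "A ** matrix_inv A = mat 1 \<and> matrix_inv A ** A = mat 1"
    unfolding matrix_inv_def by (metis (mono_tags, lifting) someI_ex)
  then show ?thesis using assms by (metis matrix_mul_assoc matrix_mul_lid matrix_mul_rid)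
qed

section \<open>Rank-one perturbations of the identity and their inverses\<close>

lemma rank_one_contract:
  fixes x y :: "'n::finite \<Rightarrow> complex"
  shows "(\<Sum>\<nu>\<in>UNIV. x \<nu> * (a * delta \<nu> \<kappa> + b * (y \<nu> * c))) = a * x \<kappa> + b * ((\<Sum>\<nu>\<in>UNIV. x \<nu> * y \<nu>) * c)"
proof -
  have "(\<Sum>\<nu>\<in>UNIV. x \<nu> * (a * delta \<nu> \<kappa> + b * (y \<nu> * c))) =
      (\<Sum>\<nu>\<in>UNIV. (a * x \<nu>) * delta \<nu> \<kappa>) + (\<Sum>\<nu>\<in>UNIV. b * ((x \<nu> * y \<nu>) * c))"
    unfolding sum.distrib[symmetric] by (rule sum.cong) (simp_all add: algebra_simps)
  then show ?thesis by (simp only: sum_delta sum_distrib_left sum_distrib_right)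
qed

text \<open>Sherman-Morrison formula. The condition on \<open>c\<close> is
  \<open>c = - F1 / (F + u F1)\<close> with the denominator cleared, where \<open>F + u F1\<close>
  is the eigenvalue in the direction of z.\<close>

lemma rank_one_inverse:
  fixes z :: "complex ^ 'n::finite"
  assumes "F \<noteq> 0" "c * (F + of_real ((norm z)\<^sup>2) * F1) = - F1"
  shows "(\<Sum>\<nu>\<in>UNIV. (F * delta \<mu> \<nu> + F1 * (cnj (z $ \<mu>) * z $ \<nu>)) *
      (1 / F * delta \<nu> \<kappa> + c / F * (cnj (z $ \<nu>) * z $ \<kappa>))) = delta \<mu> \<kappa>"
proof -
  let ?u = "of_real ((norm z)\<^sup>2) :: complex"
  have "(\<Sum>\<nu>\<in>UNIV. (F * delta \<mu> \<nu> + F1 * (cnj (z $ \<mu>) * z $ \<nu>)) * cnj (z $ \<nu>)) =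
      (\<Sum>\<nu>\<in>UNIV. cnj (z $ \<nu>) * (F * delta \<nu> \<mu> + F1 * (z $ \<nu> * cnj (z $ \<mu>))))"
    by (rule sum.cong) (simp_all add: delta_commute algebra_simps)
  also have "\<dots> = (F + ?u * F1) * cnj (z $ \<mu>)"
    unfolding rank_one_contract using sum_vec_mult_cnj[of z] by (simp add: mult_ac distrib_left)
  finally have 1: "(\<Sum>\<nu>\<in>UNIV. (F * delta \<mu> \<nu> + F1 * (cnj (z $ \<mu>) * z $ \<nu>)) * cnj (z $ \<nu>)) =
      (F + ?u * F1) * cnj (z $ \<mu>)" .
  have "c / F * ((F + ?u * F1) * cnj (z $ \<mu>) * z $ \<kappa>) =
      (c * (F + ?u * F1)) * (cnj (z $ \<mu>) * z $ \<kappa>) / F" by simp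
  also have "\<dots> = - F1 / F * (cnj (z $ \<mu>) * z $ \<kappa>)" unfolding assms(2) by simp
  finally have 2: "c / F * ((F + ?u * F1) * cnj (z $ \<mu>) * z $ \<kappa>) = - F1 / F * (cnj (z $ \<mu>) * z $ \<kappa>)" .
  show ?thesis unfolding rank_one_contract 1 2 using assms(1) by (simp add: field_simps)
qed

lemma g_inv_rank_one:
  fixes z :: "complex ^ 'n::finite"
  assumes "\<And>\<mu> \<nu>. g z $ \<mu> $ \<nu> = F * delta \<mu> \<nu> + F1 * (cnj (z $ \<mu>) * z $ \<nu>)"
    and "F \<noteq> 0" "c * (F + of_real ((norm z)\<^sup>2) * F1) = - F1"
  shows "g_inv g z \<nu> \<kappa> = 1 / F * delta \<nu> \<kappa> + c / F * (cnj (z $ \<nu>) * z $ \<kappa>)"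
proof -
  have "matrix_inv (g z) = (\<chi> \<nu> \<kappa>. 1 / F * delta \<nu> \<kappa> + c / F * (cnj (z $ \<nu>) * z $ \<kappa>))"
    by (rule matrix_inv_unique)
      (simp only: vec_eq_iff matrix_matrix_mult_def vec_lambda_beta assms(1)
        rank_one_inverse[OF assms(2,3)], simp add: mat_def delta_def)
  then show ?thesis by (simp add: g_inv_def)
qed

text \<open>The rank-one coefficient is the derivative of \<open>F\<close>; this makes the result
  symmetric in \<alpha> and \<mu>, which is the Kaehler condition.\<close>

lemma d_z_radial_metric:
  fixes z :: "complex ^ 'n::finite"
  assumes g: "\<And>w. w \<noteq> 0 \<Longrightarrow> g w $ \<mu> $ \<nu> =
      of_real (F ((norm w)\<^sup>2)) * delta \<mu> \<nu> + of_real (F1 ((norm w)\<^sup>2)) * (cnj (w $ \<mu>) * w $ \<nu>)"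
    and D: "(F has_real_derivative F1 ((norm z)\<^sup>2)) (at ((norm z)\<^sup>2))"
      "(F1 has_real_derivative F2) (at ((norm z)\<^sup>2))"
    and "z \<noteq> 0"
  shows "d_z \<alpha> (\<lambda>w. g w $ \<mu> $ \<nu>) z =
      of_real (F1 ((norm z)\<^sup>2)) * (cnj (z $ \<alpha>) * delta \<mu> \<nu> + cnj (z $ \<mu>) * delta \<alpha> \<nu>) +
      of_real F2 * (cnj (z $ \<alpha>) * cnj (z $ \<mu>) * z $ \<nu>)"
proof -
  note W = wirtinger_add[OF wirtinger_mult[OF wirtinger_radial[OF D(1)] wirtinger_const]
      wirtinger_mult[OF wirtinger_radial[OF D(2)] wirtinger_mult[OF wirtinger_cnj_coord wirtinger_coord]]]
  show ?thesis
    using wirtinger_cong[OF W open_Compl[OF closed_singleton[of 0]], where g = "\<lambda>w. g w $ \<mu> $ \<nu>"] assms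
    by (simp add: wirtinger_def algebra_simps)
qed

text \<open>The identity part of the inverse divides the derivative of g by \<open>F\<close>. The
  rank-one part sees that derivative only through its contraction with \<open>cnj z\<close>, a
  multiple \<open>2 F1 + u F2\<close> of \<open>cnj z\<^sub>\<alpha> cnj z\<^sub>\<mu>\<close>; it
  contributes the terms of \<open>q\<close> with the factor \<open>c\<close>.\<close>

lemma christoffel_radial_metric:
  fixes z :: "complex ^ 'n::finite"
  assumes g: "\<And>w \<mu> \<nu>. w \<noteq> 0 \<Longrightarrow> g w $ \<mu> $ \<nu> =
      of_real (F ((norm w)\<^sup>2)) * delta \<mu> \<nu> + of_real (F1 ((norm w)\<^sup>2)) * (cnj (w $ \<mu>) * w $ \<nu>)"
    and D: "(F has_real_derivative F1 ((norm z)\<^sup>2)) (at ((norm z)\<^sup>2))"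
      "(F1 has_real_derivative F2) (at ((norm z)\<^sup>2))"
    and "z \<noteq> 0" "F ((norm z)\<^sup>2) \<noteq> 0"
    and c: "c * (F ((norm z)\<^sup>2) + (norm z)\<^sup>2 * F1 ((norm z)\<^sup>2)) = - F1 ((norm z)\<^sup>2)"
    and p: "p = F1 ((norm z)\<^sup>2) / F ((norm z)\<^sup>2)"
    and q: "q = F2 / F ((norm z)\<^sup>2) * (1 + c * (norm z)\<^sup>2) + 2 * c * p"
  shows "christoffel g z \<kappa> \<mu> \<alpha> =
      of_real p * (cnj (z $ \<mu>) * delta \<kappa> \<alpha> + cnj (z $ \<alpha>) * delta \<kappa> \<mu>) +
      of_real q * (cnj (z $ \<alpha>) * cnj (z $ \<mu>) * z $ \<kappa>)"
proof -
  define f f1 f2 u where "f = complex_of_real (F ((norm z)\<^sup>2))"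
    and "f1 = complex_of_real (F1 ((norm z)\<^sup>2))" and "f2 = complex_of_real F2"
    and "u = complex_of_real ((norm z)\<^sup>2)"
  note defs = this
  have f: "f \<noteq> 0" using assms by (simp add: defs)
  have "of_real c * (f + u * f1) = - f1" unfolding defs using c by (metis of_real_add of_real_mult of_real_minus)
  note inv = g_inv_rank_one[where g=g and z=z, OF g[OF \<open>z \<noteq> 0\<close>, folded defs] f this[unfolded u_def]]
  let ?x = "\<lambda>\<nu>. f1 * (cnj (z $ \<alpha>) * delta \<mu> \<nu> + cnj (z $ \<mu>) * delta \<alpha> \<nu>) +
    f2 * (cnj (z $ \<alpha>) * cnj (z $ \<mu>) * z $ \<nu>)"
  have "(\<Sum>\<nu>\<in>UNIV. ?x \<nu> * cnj (z $ \<nu>)) = (\<Sum>\<nu>\<in>UNIV. (f1 * cnj (z $ \<alpha>)) * (delta \<mu> \<nu> * cnj (z $ \<nu>)))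
     + (\<Sum>\<nu>\<in>UNIV. (f1 * cnj (z $ \<mu>)) * (delta \<alpha> \<nu> * cnj (z $ \<nu>)))
     + (\<Sum>\<nu>\<in>UNIV. (f2 * cnj (z $ \<alpha>) * cnj (z $ \<mu>)) * (z $ \<nu> * cnj (z $ \<nu>)))"
    unfolding sum.distrib[symmetric] by (rule sum.cong) (simp_all add: algebra_simps)
  also have "\<dots> = (2 * f1 + f2 * u) * (cnj (z $ \<alpha>) * cnj (z $ \<mu>))"
    unfolding sum_distrib_left[symmetric] sum_delta sum_vec_mult_cnj defs by (simp add: algebra_simps)
  finally have x: "(\<Sum>\<nu>\<in>UNIV. ?x \<nu> * cnj (z $ \<nu>)) = \<dots>" .
  have dg: "d_z \<alpha> (\<lambda>w. g w $ \<mu> $ \<nu>) z = ?x \<nu>" for \<nu>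
    unfolding defs by (rule d_z_radial_metric[OF g D \<open>z \<noteq> 0\<close>])
  have pq: "of_real p = f1 / f" "of_real q = f2 / f * (1 + of_real c * u) + 2 * of_real c * (f1 / f)"
    by (simp_all add: p q defs)
  have "christoffel g z \<kappa> \<mu> \<alpha> =
      (\<Sum>\<nu>\<in>UNIV. ?x \<nu> * (1 / f * delta \<nu> \<kappa> + of_real c / f * (cnj (z $ \<nu>) * z $ \<kappa>)))"
    unfolding christoffel_def inv dg ..
  also have "\<dots> = 1 / f * ?x \<kappa> + of_real c / f * ((2 * f1 + f2 * u) * (cnj (z $ \<alpha>) * cnj (z $ \<mu>)) * z $ \<kappa>)"
    unfolding rank_one_contract x ..
  finally show ?thesis unfolding pq using f by (simp add: field_simps delta_commute)
qed

text \<open>The antiholomorphic derivative leaves the factor \<open>z $ \<kappa>\<close> alone, so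
  the upper index sits only on deltas and on z. Lowering it turns the deltas into components of g,
  and z into its multiple by the eigenvalue \<open>f + u f1\<close>.\<close>

lemma curvature_radial_metric:
  fixes z :: "complex ^ 'n::finite"
  assumes g: "\<And>\<mu> \<nu>. g z $ \<mu> $ \<nu> = f * delta \<mu> \<nu> + f1 * (cnj (z $ \<mu>) * z $ \<nu>)"
    and \<Gamma>: "\<And>w \<kappa> \<mu> \<alpha>. w \<noteq> 0 \<Longrightarrow> christoffel g w \<kappa> \<mu> \<alpha> =
      of_real (p ((norm w)\<^sup>2)) * (cnj (w $ \<mu>) * delta \<kappa> \<alpha> + cnj (w $ \<alpha>) * delta \<kappa> \<mu>) +
      of_real (q ((norm w)\<^sup>2)) * (cnj (w $ \<alpha>) * cnj (w $ \<mu>) * w $ \<kappa>)"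
    and D: "(p has_real_derivative p1) (at ((norm z)\<^sup>2))" "(q has_real_derivative q1) (at ((norm z)\<^sup>2))"
    and "z \<noteq> 0"
  shows "curvature g z \<mu> \<nu> \<alpha> \<beta> =
     - (of_real p1 * z $ \<beta> * (cnj (z $ \<mu>) * g z $ \<alpha> $ \<nu> + cnj (z $ \<alpha>) * g z $ \<mu> $ \<nu>)
      + of_real (p ((norm z)\<^sup>2)) * (delta \<mu> \<beta> * g z $ \<alpha> $ \<nu> + delta \<alpha> \<beta> * g z $ \<mu> $ \<nu>)
      + (f + of_real ((norm z)\<^sup>2) * f1) * z $ \<nu> *
        (of_real q1 * (z $ \<beta> * cnj (z $ \<alpha>) * cnj (z $ \<mu>)) +
         of_real (q ((norm z)\<^sup>2)) * (delta \<alpha> \<beta> * cnj (z $ \<mu>) + delta \<mu> \<beta> * cnj (z $ \<alpha>))))"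
proof -
  define P where "P = of_real p1 * z $ \<beta> * cnj (z $ \<mu>) + of_real (p ((norm z)\<^sup>2)) * delta \<mu> \<beta>"
  define Q where "Q = of_real p1 * z $ \<beta> * cnj (z $ \<alpha>) + of_real (p ((norm z)\<^sup>2)) * delta \<alpha> \<beta>"
  define T where "T = of_real q1 * (z $ \<beta> * cnj (z $ \<alpha>) * cnj (z $ \<mu>)) +
         of_real (q ((norm z)\<^sup>2)) * (delta \<alpha> \<beta> * cnj (z $ \<mu>) + delta \<mu> \<beta> * cnj (z $ \<alpha>))"
  have up: "curvature_up g z \<kappa> \<mu> \<beta> \<alpha> = - (P * delta \<kappa> \<alpha> + Q * delta \<kappa> \<mu> + T * z $ \<kappa>)" for \<kappa>
  proof -
    note W = wirtinger_add[OF wirtinger_mult[OF wirtinger_radial[OF D(1)]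
        wirtinger_add[OF wirtinger_mult[OF wirtinger_cnj_coord[where \<mu>=\<mu>] wirtinger_const[where c="delta \<kappa> \<alpha>"]]
          wirtinger_mult[OF wirtinger_cnj_coord[where \<mu>=\<alpha>] wirtinger_const[where c="delta \<kappa> \<mu>"]]]]
      wirtinger_mult[OF wirtinger_radial[OF D(2)]
        wirtinger_mult[OF wirtinger_mult[OF wirtinger_cnj_coord[where \<mu>=\<alpha>] wirtinger_cnj_coord[where \<mu>=\<mu>]]
          wirtinger_coord[where \<mu>=\<kappa>]]], where \<alpha>=\<beta>]
    show ?thesis
      using wirtinger_cong[OF W open_Compl[OF closed_singleton[of 0]], where g = "\<lambda>w. christoffel g w \<kappa> \<mu> \<alpha>"] \<Gamma> \<open>z \<noteq> 0\<close>
      unfolding curvature_up_def P_def Q_def T_def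
      by (simp add: wirtinger_def algebra_simps delta_commute)
  qed
  have 1: "(\<Sum>\<kappa>\<in>UNIV. g z $ \<kappa> $ \<nu> * z $ \<kappa>) = (f + of_real ((norm z)\<^sup>2) * f1) * z $ \<nu>"
  proof -
    have "(\<Sum>\<kappa>\<in>UNIV. g z $ \<kappa> $ \<nu> * z $ \<kappa>) =
        (\<Sum>\<kappa>\<in>UNIV. z $ \<kappa> * (f * delta \<kappa> \<nu> + f1 * (cnj (z $ \<kappa>) * z $ \<nu>)))"
      unfolding g by (rule sum.cong) (simp_all add: mult_ac)
    then show ?thesis unfolding rank_one_contract sum_vec_mult_cnj by (simp add: algebra_simps)
  qed
  have "curvature g z \<mu> \<nu> \<alpha> \<beta> = - ((\<Sum>\<kappa>\<in>UNIV. P * (g z $ \<kappa> $ \<nu> * delta \<kappa> \<alpha>)) +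
     (\<Sum>\<kappa>\<in>UNIV. Q * (g z $ \<kappa> $ \<nu> * delta \<kappa> \<mu>)) + (\<Sum>\<kappa>\<in>UNIV. T * (g z $ \<kappa> $ \<nu> * z $ \<kappa>)))"
    unfolding curvature_def up sum.distrib[symmetric] sum_negf[symmetric]
    by (rule sum.cong) (simp_all add: algebra_simps)
  also have "\<dots> = - (P * g z $ \<alpha> $ \<nu> + Q * g z $ \<mu> $ \<nu> + T * ((f + of_real ((norm z)\<^sup>2) * f1) * z $ \<nu>))"
    unfolding sum_distrib_left[symmetric] sum_delta 1 ..
  finally show ?thesis unfolding P_def Q_def T_def by (simp add: algebra_simps)
qed

subsection \<open>Traces of operators on a tensor square\<close>

text \<open>
  The matrix of \<open>p (A \<otimes> A) + q (A \<otimes> B + B \<otimes> A) + r (B \<otimes> B)\<close>; the indices \<open>\<mu>\<close>, \<open>\<nu>\<close> belong to the first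
  tensor factor and \<open>\<alpha>\<close>, \<open>\<beta>\<close> to the second.
\<close>

definition tensor_form :: "complex \<Rightarrow> complex \<Rightarrow> complex \<Rightarrow> ('n \<Rightarrow> 'n \<Rightarrow> complex) \<Rightarrow> ('n \<Rightarrow> 'n \<Rightarrow> complex) \<Rightarrow>
    'n \<Rightarrow> 'n \<Rightarrow> 'n \<Rightarrow> 'n \<Rightarrow> complex" where
  "tensor_form p q r A B \<mu> \<nu> \<alpha> \<beta> =
     p * (A \<mu> \<nu> * A \<alpha> \<beta>) + q * (A \<mu> \<nu> * B \<alpha> \<beta> + B \<mu> \<nu> * A \<alpha> \<beta>) + r * (B \<mu> \<nu> * B \<alpha> \<beta>)"

lemma tensor_form_swap: "tensor_form p q r A B \<mu> \<nu> \<alpha> \<beta> = tensor_form p q r A B \<alpha> \<beta> \<mu> \<nu>"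
  by (simp add: tensor_form_def algebra_simps)

lemma double_sum_linear: "(\<Sum>\<nu>\<in>I. \<Sum>\<beta>\<in>J. f \<nu> \<beta> + g \<nu> \<beta>) = (\<Sum>\<nu>\<in>I. \<Sum>\<beta>\<in>J. f \<nu> \<beta>) + (\<Sum>\<nu>\<in>I. \<Sum>\<beta>\<in>J. g \<nu> \<beta>)"
  "(\<Sum>\<nu>\<in>I. \<Sum>\<beta>\<in>J. c * f \<nu> \<beta>) = c * (\<Sum>\<nu>\<in>I. \<Sum>\<beta>\<in>J. f \<nu> \<beta>)" for f :: "_ \<Rightarrow> _ \<Rightarrow> complex"
  by (simp_all add: sum.distrib sum_distrib_left)

lemma double_sum_contract:
  fixes A B C D :: "'n::finite \<Rightarrow> 'n \<Rightarrow> complex"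
  shows "(\<Sum>\<nu>\<in>UNIV. \<Sum>\<beta>\<in>UNIV. (A \<mu> \<nu> * B \<alpha> \<beta>) * (C \<nu> \<kappa> * D \<beta> \<tau>)) =
    (\<Sum>\<nu>\<in>UNIV. A \<mu> \<nu> * C \<nu> \<kappa>) * (\<Sum>\<beta>\<in>UNIV. B \<alpha> \<beta> * D \<beta> \<tau>)"
  unfolding sum_product by (intro sum.cong refl) (simp only: mult_ac)

lemma tensor_form_contract:
  fixes A B C :: "'n::finite \<Rightarrow> 'n \<Rightarrow> complex"
  assumes A: "\<And>\<mu> \<kappa>. (\<Sum>\<nu>\<in>UNIV. A \<mu> \<nu> * C \<nu> \<kappa>) = A' \<mu> \<kappa>"
   and B: "\<And>\<mu> \<kappa>. (\<Sum>\<nu>\<in>UNIV. B \<mu> \<nu> * C \<nu> \<kappa>) = B' \<mu> \<kappa>"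
  shows "(\<Sum>\<nu>\<in>UNIV. \<Sum>\<beta>\<in>UNIV. tensor_form p q r A B \<mu> \<nu> \<alpha> \<beta> * (C \<nu> \<kappa> * C \<beta> \<tau>)) = tensor_form p q r A' B' \<mu> \<kappa> \<alpha> \<tau>"
proof -
  have "(\<Sum>\<nu>\<in>UNIV. \<Sum>\<beta>\<in>UNIV. tensor_form p q r A B \<mu> \<nu> \<alpha> \<beta> * (C \<nu> \<kappa> * C \<beta> \<tau>)) =
     (\<Sum>\<nu>\<in>UNIV. \<Sum>\<beta>\<in>UNIV. p * ((A \<mu> \<nu> * A \<alpha> \<beta>) * (C \<nu> \<kappa> * C \<beta> \<tau>)) +
        (q * ((A \<mu> \<nu> * B \<alpha> \<beta>) * (C \<nu> \<kappa> * C \<beta> \<tau>)) + (q * ((B \<mu> \<nu> * A \<alpha> \<beta>) * (C \<nu> \<kappa> * C \<beta> \<tau>)) +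
         r * ((B \<mu> \<nu> * B \<alpha> \<beta>) * (C \<nu> \<kappa> * C \<beta> \<tau>)))))"
    by (intro sum.cong refl) (simp add: tensor_form_def algebra_simps)
  also have "\<dots> = tensor_form p q r A' B' \<mu> \<kappa> \<alpha> \<tau>"
    unfolding double_sum_linear double_sum_contract A B tensor_form_def by (simp add: algebra_simps)
  finally show ?thesis .
qed

text \<open>For projections that annihilate each other, \<open>A \<otimes> A\<close>,
  \<open>A \<otimes> B + B \<otimes> A\<close> and \<open>B \<otimes> B\<close> are again mutually
  annihilating idempotents, so squaring acts on the coefficients.\<close>

lemma tensor_form_projections_mult:
  fixes A B :: "'n::finite \<Rightarrow> 'n \<Rightarrow> complex"
  assumes "\<And>\<mu> \<kappa>. (\<Sum>\<nu>\<in>UNIV. A \<mu> \<nu> * A \<nu> \<kappa>) = A \<mu> \<kappa>" "\<And>\<mu> \<kappa>. (\<Sum>\<nu>\<in>UNIV. B \<mu> \<nu> * B \<nu> \<kappa>) = B \<mu> \<kappa>"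
    "\<And>\<mu> \<kappa>. (\<Sum>\<nu>\<in>UNIV. A \<mu> \<nu> * B \<nu> \<kappa>) = 0" "\<And>\<mu> \<kappa>. (\<Sum>\<nu>\<in>UNIV. B \<mu> \<nu> * A \<nu> \<kappa>) = 0"
  shows "(\<Sum>\<nu>\<in>UNIV. \<Sum>\<beta>\<in>UNIV. tensor_form p q r A B \<mu> \<nu> \<alpha> \<beta> * tensor_form p q r A B \<nu> \<kappa> \<beta> \<tau>) =
    tensor_form (p\<^sup>2) (q\<^sup>2) (r\<^sup>2) A B \<mu> \<kappa> \<alpha> \<tau>"
proof -
  have "(\<Sum>\<nu>\<in>UNIV. \<Sum>\<beta>\<in>UNIV. tensor_form p q r A B \<mu> \<nu> \<alpha> \<beta> * tensor_form p q r A B \<nu> \<kappa> \<beta> \<tau>) =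
    (\<Sum>\<nu>\<in>UNIV. \<Sum>\<beta>\<in>UNIV. p * (tensor_form p q r A B \<mu> \<nu> \<alpha> \<beta> * (A \<nu> \<kappa> * A \<beta> \<tau>)) +
       (q * (tensor_form p q r A B \<mu> \<nu> \<alpha> \<beta> * (A \<nu> \<kappa> * B \<beta> \<tau>)) + (q * (tensor_form p q r A B \<mu> \<nu> \<alpha> \<beta> * (B \<nu> \<kappa> * A \<beta> \<tau>))
       + r * (tensor_form p q r A B \<mu> \<nu> \<alpha> \<beta> * (B \<nu> \<kappa> * B \<beta> \<tau>)))))"
    by (intro sum.cong refl) (simp add: tensor_form_def[of _ _ _ _ _ _ \<kappa>] algebra_simps)
  also have "\<dots> = tensor_form (p\<^sup>2) (q\<^sup>2) (r\<^sup>2) A B \<mu> \<kappa> \<alpha> \<tau>"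
  proof -
    have X: "(\<Sum>\<nu>\<in>UNIV. \<Sum>\<beta>\<in>UNIV. tensor_form p q r A B \<mu> \<nu> \<alpha> \<beta> * (C \<nu> \<kappa> * D \<beta> \<tau>)) =
      p * ((\<Sum>\<nu>\<in>UNIV. A \<mu> \<nu> * C \<nu> \<kappa>) * (\<Sum>\<nu>\<in>UNIV. A \<alpha> \<nu> * D \<nu> \<tau>)) +
      (q * ((\<Sum>\<nu>\<in>UNIV. A \<mu> \<nu> * C \<nu> \<kappa>) * (\<Sum>\<nu>\<in>UNIV. B \<alpha> \<nu> * D \<nu> \<tau>)) +
      (q * ((\<Sum>\<nu>\<in>UNIV. B \<mu> \<nu> * C \<nu> \<kappa>) * (\<Sum>\<nu>\<in>UNIV. A \<alpha> \<nu> * D \<nu> \<tau>)) +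
      r * ((\<Sum>\<nu>\<in>UNIV. B \<mu> \<nu> * C \<nu> \<kappa>) * (\<Sum>\<nu>\<in>UNIV. B \<alpha> \<nu> * D \<nu> \<tau>))))" for C D
      unfolding double_sum_contract[symmetric] double_sum_linear[symmetric]
      by (intro sum.cong refl) (simp add: tensor_form_def algebra_simps)
    show ?thesis unfolding double_sum_linear X assms by (simp add: tensor_form_def power2_eq_square algebra_simps)
  qed
  finally show ?thesis .
qed

text \<open>Here X = (1 + s) Y with s the swap of the factors. Since s commutes with Y and (1 + s)^2
  = 2 (1 + s), the trace of X^2 is 2 tr (Y^2) + 2 tr (s Y^2); moreover
  \<open>tr (s (A \<otimes> B)) = tr (A B)\<close>, which yields the linear terms \<open>a\<close>
  and \<open>b\<close>.\<close>

lemma tensor_form_symmetrized_square_trace: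
  fixes A B :: "'n::finite \<Rightarrow> 'n \<Rightarrow> complex"
  assumes P: "\<And>\<mu> \<kappa>. (\<Sum>\<nu>\<in>UNIV. A \<mu> \<nu> * A \<nu> \<kappa>) = A \<mu> \<kappa>" "\<And>\<mu> \<kappa>. (\<Sum>\<nu>\<in>UNIV. B \<mu> \<nu> * B \<nu> \<kappa>) = B \<mu> \<kappa>"
    "\<And>\<mu> \<kappa>. (\<Sum>\<nu>\<in>UNIV. A \<mu> \<nu> * B \<nu> \<kappa>) = 0" "\<And>\<mu> \<kappa>. (\<Sum>\<nu>\<in>UNIV. B \<mu> \<nu> * A \<nu> \<kappa>) = 0"
    and T: "(\<Sum>\<mu>\<in>UNIV. A \<mu> \<mu>) = a" "(\<Sum>\<mu>\<in>UNIV. B \<mu> \<mu>) = b"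
    and X: "\<And>\<mu> \<nu> \<alpha> \<beta>. X \<mu> \<nu> \<alpha> \<beta> = tensor_form p q r A B \<mu> \<nu> \<alpha> \<beta> + tensor_form p q r A B \<alpha> \<nu> \<mu> \<beta>"
  shows "(\<Sum>\<mu>\<in>UNIV. \<Sum>\<alpha>\<in>UNIV. \<Sum>\<nu>\<in>UNIV. \<Sum>\<beta>\<in>UNIV. X \<mu> \<nu> \<alpha> \<beta> * X \<nu> \<mu> \<beta> \<alpha>) =
    2 * (p\<^sup>2 * (a\<^sup>2 + a) + 2 * q\<^sup>2 * a * b + r\<^sup>2 * (b\<^sup>2 + b))"
proof -
  let ?Y = "tensor_form p q r A B" and ?Y2 = "tensor_form (p\<^sup>2) (q\<^sup>2) (r\<^sup>2) A B"
  have "(\<Sum>\<nu>\<in>UNIV. \<Sum>\<beta>\<in>UNIV. X \<mu> \<nu> \<alpha> \<beta> * X \<nu> \<mu> \<beta> \<alpha>) = 2 * (?Y2 \<mu> \<mu> \<alpha> \<alpha> + ?Y2 \<mu> \<alpha> \<alpha> \<mu>)" for \<mu> \<alpha>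
  proof -
    have "(\<Sum>\<nu>\<in>UNIV. \<Sum>\<beta>\<in>UNIV. X \<mu> \<nu> \<alpha> \<beta> * X \<nu> \<mu> \<beta> \<alpha>) =
      (\<Sum>\<nu>\<in>UNIV. \<Sum>\<beta>\<in>UNIV. ?Y \<mu> \<nu> \<alpha> \<beta> * ?Y \<nu> \<mu> \<beta> \<alpha> + (?Y \<mu> \<nu> \<alpha> \<beta> * ?Y \<nu> \<alpha> \<beta> \<mu> +
        (?Y \<alpha> \<nu> \<mu> \<beta> * ?Y \<nu> \<mu> \<beta> \<alpha> + ?Y \<alpha> \<nu> \<mu> \<beta> * ?Y \<nu> \<alpha> \<beta> \<mu>)))"
    proof (intro sum.cong refl)
      fix \<nu> \<beta>
      have "X \<nu> \<mu> \<beta> \<alpha> = ?Y \<nu> \<mu> \<beta> \<alpha> + ?Y \<nu> \<alpha> \<beta> \<mu>" unfolding X by (simp only: tensor_form_swap[of _ _ _ _ _ \<beta> \<mu>])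
      then show "X \<mu> \<nu> \<alpha> \<beta> * X \<nu> \<mu> \<beta> \<alpha> = ?Y \<mu> \<nu> \<alpha> \<beta> * ?Y \<nu> \<mu> \<beta> \<alpha> + (?Y \<mu> \<nu> \<alpha> \<beta> * ?Y \<nu> \<alpha> \<beta> \<mu> +
        (?Y \<alpha> \<nu> \<mu> \<beta> * ?Y \<nu> \<mu> \<beta> \<alpha> + ?Y \<alpha> \<nu> \<mu> \<beta> * ?Y \<nu> \<alpha> \<beta> \<mu>))" unfolding X by (simp add: algebra_simps)
    qed
    also have "\<dots> = ?Y2 \<mu> \<mu> \<alpha> \<alpha> + (?Y2 \<mu> \<alpha> \<alpha> \<mu> + (?Y2 \<alpha> \<mu> \<mu> \<alpha> + ?Y2 \<alpha> \<alpha> \<mu> \<mu>))"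
      unfolding double_sum_linear tensor_form_projections_mult[OF P] ..
    finally show ?thesis by (simp add: tensor_form_swap[of _ _ _ _ _ \<alpha>])
  qed
  moreover have "(\<Sum>\<mu>\<in>UNIV. \<Sum>\<alpha>\<in>UNIV. ?Y2 \<mu> \<mu> \<alpha> \<alpha>) = p\<^sup>2 * a\<^sup>2 + 2 * q\<^sup>2 * a * b + r\<^sup>2 * b\<^sup>2"
  proof -
    have S: "(\<Sum>\<mu>\<in>UNIV. \<Sum>\<alpha>\<in>UNIV. C \<mu> \<mu> * D \<alpha> \<alpha>) = (\<Sum>\<mu>\<in>UNIV. C \<mu> \<mu>) * (\<Sum>\<mu>\<in>UNIV. D \<mu> \<mu>)"
      for C D :: "'n \<Rightarrow> 'n \<Rightarrow> complex"
      by (simp add: sum_product)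
    show ?thesis unfolding tensor_form_def double_sum_linear S T by (simp add: power2_eq_square algebra_simps)
  qed
  moreover have "(\<Sum>\<mu>\<in>UNIV. \<Sum>\<alpha>\<in>UNIV. ?Y2 \<mu> \<alpha> \<alpha> \<mu>) = p\<^sup>2 * a + r\<^sup>2 * b"
    unfolding tensor_form_def double_sum_linear P T by simp
  ultimately show ?thesis by (simp only: double_sum_linear) (simp add: algebra_simps)
qed

section \<open>The Kretschmann sum as a trace\<close>

text \<open>The new order puts the four indices that survive the contractions outermost, then the
  pair raised in the curvature, then the pair raised in its conjugate.\<close>

lemma sum8_reorder:
  fixes T :: "'n::finite \<Rightarrow> 'n \<Rightarrow> 'n \<Rightarrow> 'n \<Rightarrow> 'n \<Rightarrow> 'n \<Rightarrow> 'n \<Rightarrow> 'n \<Rightarrow> 'a::comm_monoid_add"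
  shows "(\<Sum>a\<in>UNIV. \<Sum>b\<in>UNIV. \<Sum>c\<in>UNIV. \<Sum>d\<in>UNIV. \<Sum>e\<in>UNIV. \<Sum>f\<in>UNIV. \<Sum>g\<in>UNIV. \<Sum>h\<in>UNIV. T a b c d e f g h) =
    (\<Sum>a\<in>UNIV. \<Sum>c\<in>UNIV. \<Sum>f\<in>UNIV. \<Sum>h\<in>UNIV. \<Sum>b\<in>UNIV. \<Sum>d\<in>UNIV. \<Sum>e\<in>UNIV. \<Sum>g\<in>UNIV. T a b c d e f g h)"
  unfolding sum.cartesian_product UNIV_Times_UNIV
  by (rule sum.reindex_bij_witness[where i = "\<lambda>(a,c,f,h,b,d,e,g). (a,b,c,d,e,f,g,h)"
      and j = "\<lambda>(a,b,c,d,e,f,g,h). (a,c,f,h,b,d,e,g)"]) auto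

text \<open>Two of the four inverse metrics are absorbed by each curvature factor. Both factors
  become the same operator \<open>X\<close>, and the remaining index pairs are linked as in the
  trace of its square.\<close>

lemma kretschmann_of_contractions:
  fixes z :: "complex ^ 'n::finite"
  assumes "\<And>\<mu> \<alpha> \<kappa> \<tau>. (\<Sum>\<nu>\<in>UNIV. \<Sum>\<beta>\<in>UNIV. curvature g z \<mu> \<nu> \<alpha> \<beta> * (g_inv g z \<nu> \<kappa> * g_inv g z \<beta> \<tau>)) = X \<mu> \<kappa> \<alpha> \<tau>"
    and "\<And>\<nu> \<beta> \<kappa> \<tau>. (\<Sum>\<mu>\<in>UNIV. \<Sum>\<alpha>\<in>UNIV. cnj (curvature g z \<mu> \<nu> \<alpha> \<beta>) * (g_inv g z \<mu> \<kappa> * g_inv g z \<alpha> \<tau>)) = X \<nu> \<kappa> \<beta> \<tau>"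
  shows "kretschmann g z = (\<Sum>\<mu>\<in>UNIV. \<Sum>\<alpha>\<in>UNIV. \<Sum>\<nu>\<in>UNIV. \<Sum>\<beta>\<in>UNIV. X \<mu> \<nu> \<alpha> \<beta> * X \<nu> \<mu> \<beta> \<alpha>)"
proof -
  let ?R = "curvature g z" and ?I = "g_inv g z"
  have 1: "(\<Sum>b\<in>UNIV. \<Sum>d\<in>UNIV. \<Sum>e\<in>UNIV. \<Sum>k\<in>UNIV. s b d * t e k) = (\<Sum>b\<in>UNIV. \<Sum>d\<in>UNIV. s b d) * (\<Sum>e\<in>UNIV. \<Sum>k\<in>UNIV. t e k)"
    for s t :: "'n \<Rightarrow> 'n \<Rightarrow> complex"
    by (simp only: sum_distrib_left[symmetric] sum_distrib_right[symmetric])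
  have "kretschmann g z = (\<Sum>\<mu>\<in>UNIV. \<Sum>\<alpha>\<in>UNIV. \<Sum>\<nu>'\<in>UNIV. \<Sum>\<beta>'\<in>UNIV. \<Sum>\<nu>\<in>UNIV. \<Sum>\<beta>\<in>UNIV. \<Sum>\<mu>'\<in>UNIV. \<Sum>\<alpha>'\<in>UNIV.
     (?R \<mu> \<nu> \<alpha> \<beta> * (?I \<nu> \<nu>' * ?I \<beta> \<beta>')) * (cnj (?R \<mu>' \<nu>' \<alpha>' \<beta>') * (?I \<mu>' \<mu> * ?I \<alpha>' \<alpha>)))"
    unfolding kretschmann_def
    by (rule trans[OF sum8_reorder], intro sum.cong refl) (simp only: mult_ac)
  then show ?thesis unfolding 1 assms .
qed

subsection \<open>The radial profile\<close>

text \<open>With \<open>A = a ^ n\<close> this is the derivative of the Kaehler potential as a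
  function of |z|^2. \<open>log_slope\<close> is its logarithmic derivative.\<close>

definition slope :: "nat \<Rightarrow> real \<Rightarrow> real \<Rightarrow> real" where
  "slope n A x = root n (1 + A / x ^ n)"

definition log_slope :: "nat \<Rightarrow> real \<Rightarrow> real \<Rightarrow> real" where
  "log_slope n A x = - A / (x * (A + x ^ n))"

definition log_slope' :: "nat \<Rightarrow> real \<Rightarrow> real \<Rightarrow> real" where
  "log_slope' n A x = A * (A + real (n + 1) * x ^ n) / (x * (A + x ^ n))\<^sup>2"

lemma slope_eq:
  assumes "n > 0" "A > 0" "x > 0"
  shows "slope n A x = root n (A + x ^ n) / x"
proof -
  have "1 + A / x ^ n = (A + x ^ n) / x ^ n" using assms by (simp add: field_simps)
  then show ?thesis using assms by (simp add: slope_def real_root_divide real_root_power_cancel)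
qed

lemma slope_pos: "n > 0 \<Longrightarrow> A > 0 \<Longrightarrow> x > 0 \<Longrightarrow> slope n A x > 0"
  by (simp add: slope_def real_root_gt_zero add_pos_pos)

lemma DERIV_slope:
  assumes "n > 0" "A > 0" "x > 0"
  shows "(slope n A has_real_derivative slope n A x * log_slope n A x) (at x)"
proof -
  define y where "y = 1 + A / x ^ n"
  have y: "y > 0" using assms by (simp add: y_def add_pos_pos)
  have r: "root n y > 0" "root n y ^ n = y" using assms y by auto
  \<comment> \<open>The derivative of the root has \<open>root n y ^ (n - 1)\<close> in its
    denominator. Rewriting it with denominator \<open>y\<close> brings the root itself to the front,
    so the result is a multiple of \<open>slope\<close>.\<close>
  have 1: "root n y * root n y ^ (n - Suc 0) = y" using r(2) assms(1) by (simp flip: power_Suc)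
  have 2: "inverse (real n * root n y ^ (n - Suc 0)) = root n y / (real n * y)"
  proof -
    have "root n y ^ (n - Suc 0) = y / root n y" using 1 r by (simp add: field_simps)
    then show ?thesis using r by simp
  qed
  have x: "x * x ^ (n - 1) = x ^ n" using assms by (simp flip: power_Suc)
  have "((\<lambda>x. 1 + A / x ^ n) has_real_derivative
      0 + (0 * x ^ n - A * (real n * x ^ (n - 1))) / (x ^ n * x ^ n)) (at x)"
    using assms by (intro DERIV_add DERIV_divide DERIV_const) (auto intro!: derivative_eq_intros)
  also have "0 + (0 * x ^ n - A * (real n * x ^ (n - 1))) / (x ^ n * x ^ n) =
      - (real n * A / (x * x ^ n))"
    using assms by (simp add: x[symmetric])
  finally have 3: "((\<lambda>x. 1 + A / x ^ n) has_real_derivative - (real n * A / (x * x ^ n))) (at x)" .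
  have "(slope n A has_real_derivative
      inverse (real n * root n y ^ (n - Suc 0)) * - (real n * A / (x * x ^ n))) (at x)"
    unfolding slope_def
    by (rule DERIV_chain2[OF _ 3]) (use DERIV_real_root[of n y] assms y in \<open>simp add: y_def\<close>)
  also have "inverse (real n * root n y ^ (n - Suc 0)) * - (real n * A / (x * x ^ n)) =
      slope n A x * (- (A / (y * (x * x ^ n))))"
    unfolding 2 slope_def y_def[symmetric] using assms y by (simp add: field_simps)
  also have "y * (x * x ^ n) = x * (A + x ^ n)" using assms by (simp add: y_def field_simps)
  finally show ?thesis by (simp add: log_slope_def)
qed

lemma DERIV_log_slope:
  assumes "n > 0" "A > 0" "x > 0"
  shows "(log_slope n A has_real_derivative log_slope' n A x) (at x)"
proof -
  have x: "x * x ^ (n - 1) = x ^ n" using assms by (simp flip: power_Suc)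
  have s: "A + x ^ n > 0" using assms by (simp add: add_pos_pos)
  have "((\<lambda>x. x * (A + x ^ n)) has_real_derivative (A + x ^ n) + x * (real n * x ^ (n - 1))) (at x)"
    by (auto intro!: derivative_eq_intros)
  also have "(A + x ^ n) + x * (real n * x ^ (n - 1)) = A + real (n + 1) * x ^ n"
    by (simp add: x[symmetric] algebra_simps)
  finally have "((\<lambda>x. - A / (x * (A + x ^ n))) has_real_derivative
      (0 * (x * (A + x ^ n)) - - A * (A + real (n + 1) * x ^ n)) / ((x * (A + x ^ n)) * (x * (A + x ^ n)))) (at x)"
    using s assms by (intro DERIV_divide DERIV_const) auto
  then show ?thesis unfolding log_slope_def log_slope'_def by (simp add: power2_eq_square)
qed

text \<open>Multiplying the power by one more factor \<open>x / root n (A + x ^ n)\<close> removes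
  the root. The first equation identifies the factor in the curvature formula with the eigenvalue
  \<open>F + x F'\<close>; with the second it says \<open>det g = 1\<close>.\<close>

lemma slope_root_power:
  assumes "n > 0" "A > 0" "x > 0"
  shows "(x / root n (A + x ^ n)) ^ (n - 1) = slope n A x * (1 + x * log_slope n A x)"
    and "1 + x * log_slope n A x = x ^ n / (A + x ^ n)"
proof -
  have s: "A + x ^ n > 0" using assms by (simp add: add_pos_pos)
  have r: "root n (A + x ^ n) > 0" "root n (A + x ^ n) ^ n = A + x ^ n" using assms s by auto
  have "x / root n (A + x ^ n) * (x / root n (A + x ^ n)) ^ (n - 1) = (x / root n (A + x ^ n)) ^ n"
    using assms(1) by (simp flip: power_Suc)
  also have "\<dots> = x ^ n / (A + x ^ n)" by (simp add: power_divide r)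
  finally have 1: "x / root n (A + x ^ n) * (x / root n (A + x ^ n)) ^ (n - 1) = x ^ n / (A + x ^ n)" .
  show 2: "1 + x * log_slope n A x = x ^ n / (A + x ^ n)"
  proof -
    have "x * log_slope n A x = - A / (A + x ^ n)" using assms by (simp add: log_slope_def)
    moreover have "A / (A + x ^ n) + x ^ n / (A + x ^ n) = 1"
      using s by (simp flip: add_divide_distrib)
    ultimately show ?thesis by simp
  qed
  show "(x / root n (A + x ^ n)) ^ (n - 1) = slope n A x * (1 + x * log_slope n A x)"
    unfolding 2 1[symmetric] slope_eq[OF assms] using r assms by (simp add: field_simps)
qed

lemma powr_root_quotient:
  assumes "n > 0" "A > 0" "x > 0"
  shows "(A + x ^ n) powr (real (n + 1) / real n) = (A + x ^ n) * root n (A + x ^ n)"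
proof -
  have s: "A + x ^ n > 0" using assms by (simp add: add_pos_pos)
  have "real (n + 1) / real n = 1 + 1 / real n" using assms by (simp add: field_simps)
  then show ?thesis using s assms by (simp add: powr_add root_powr_inverse)
qed

text \<open>
  The four relations are exactly what makes the product-rule form of the curvature agree with its
  expression through \<open>g\<close>; the last two concern the quotient \<open>- (n + 1) p / x\<close> and its derivative.
\<close>

lemma curvature_coefficients:
  assumes "n > 0" "A > 0" "x > 0"
  defines "C \<equiv> A / (A + x ^ n) powr (real (n + 1) / real n)"
    and "W \<equiv> (x / root n (A + x ^ n)) ^ (n - 1)"
    and "f \<equiv> slope n A x" and "p \<equiv> log_slope n A x" and "p1 \<equiv> log_slope' n A x"
    and "N \<equiv> real n"
  shows "p = - (C * f)" "p1 = p\<^sup>2 + C * (N + 1) * W / x"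
    "W * (- (N + 1) * p / x) = C * (N + 1) * W / x * f"
    "W * (- (N + 1) * (p1 / x - p / x\<^sup>2)) =
       2 * (C * (N + 1) * W / x * f) * p - C * ((N + 1) * (N + 2)) * W\<^sup>2 / x\<^sup>2"
proof -
  have s: "A + x ^ n > 0" using assms(1-3) by (simp add: add_pos_pos)
  have r: "root n (A + x ^ n) > 0" using assms(1-3) s by auto
  have C: "C = A / ((A + x ^ n) * root n (A + x ^ n))" unfolding C_def powr_root_quotient[OF assms(1-3)] ..
  have W: "W = root n (A + x ^ n) / x * (x ^ n / (A + x ^ n))"
    unfolding W_def slope_root_power[OF assms(1-3)] slope_eq[OF assms(1-3)] ..
  have f: "f = root n (A + x ^ n) / x" unfolding f_def slope_eq[OF assms(1-3)] ..
  show p: "p = - (C * f)" using s r assms(1-3) by (simp add: C f p_def log_slope_def)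
  have CW: "C * W = A * x ^ n / (x * (A + x ^ n)\<^sup>2)"
    using s r assms(1-3) by (simp add: C W power2_eq_square)
  have "p1 = (A * A + (N + 1) * (A * x ^ n)) / (x * (A + x ^ n))\<^sup>2"
    unfolding p1_def log_slope'_def N_def by (simp add: algebra_simps)
  also have "\<dots> = p\<^sup>2 + (N + 1) * (C * W) / x"
    unfolding CW p_def log_slope_def using s assms(2,3)
    by (simp add: power_divide power_mult_distrib add_divide_distrib power2_eq_square)
  finally show p1: "p1 = p\<^sup>2 + C * (N + 1) * W / x" by (simp add: mult_ac)
  show "W * (- (N + 1) * p / x) = C * (N + 1) * W / x * f"
    unfolding p by (simp add: divide_inverse algebra_simps)
  have q: "1 / x + p = W / f / x"
    using slope_root_power(1)[OF assms(1-3)] slope_pos[OF assms(1-3)] assms(3)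
    by (simp add: W_def f_def p_def field_simps)
  have "f > 0" using slope_pos[OF assms(1-3)] by (simp add: f_def)
  have "p1 / x - p / x\<^sup>2 = (p\<^sup>2 + C * (N + 1) * W / x) / x - p / x\<^sup>2" using p1 by simp
  \<comment> \<open>The term \<open>p\<^sup>2 / x\<close> is added and subtracted to produce
    \<open>1 / x + p\<close>, which is \<open>W / (f * x)\<close>. As \<open>p = - (C * f)\<close>,
    the \<open>f\<close> cancels and one more \<open>C * W / x\<^sup>2\<close> remains: this turns
    \<open>N + 1\<close> into \<open>N + 2\<close>.\<close>
  also have "\<dots> = 2 * p * p / x + (C * (N + 1) * W) / x\<^sup>2 - p / x * (1 / x + p)"
    using assms(3) by (simp add: field_simps power2_eq_square)
  also have "p / x * (1 / x + p) = - (C * W) / x\<^sup>2"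
    unfolding q unfolding p using \<open>f > 0\<close> by (simp add: power2_eq_square)
  finally have Q: "p1 / x - p / x\<^sup>2 = 2 * p * p / x + C * (N + 2) * W / x\<^sup>2"
    by (simp add: algebra_simps add_divide_distrib)
  have "W * (- (N + 1) * (p1 / x - p / x\<^sup>2)) =
     2 * (- ((N + 1) * W * p / x)) * p - C * ((N + 1) * (N + 2)) * W\<^sup>2 / x\<^sup>2"
    unfolding Q by (simp add: divide_inverse algebra_simps power2_eq_square)
  also have "- ((N + 1) * W * p / x) = C * (N + 1) * W / x * f" by (simp add: p)
  finally show "W * (- (N + 1) * (p1 / x - p / x\<^sup>2)) =
       2 * (C * (N + 1) * W / x * f) * p - C * ((N + 1) * (N + 2)) * W\<^sup>2 / x\<^sup>2" .
qed

text \<open>A polynomial identity, with \<open>c1\<close>, \<open>c2\<close> for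
  \<open>cnj z\<close> at \<mu>, \<alpha>; \<open>z1\<close>, \<open>z2\<close> for z at \<nu>,
  \<beta>; \<open>d1\<close>, \<open>d2\<close> for the deltas with \<beta>; and \<open>G1\<close>
  to \<open>G4\<close> for g at \<alpha>\<nu>, \<mu>\<nu>, \<mu>\<beta>, \<alpha>\<beta>. The
  eigenvalue \<open>w\<close> occurs only next to \<open>q\<close> and \<open>q1\<close>, hence the
  hypotheses on these products.\<close>

lemma curvature_assembly:
  fixes C f p p1 q q1 w V V2 :: complex
  assumes G: "G3 = f * d1 + f * p * (c1 * z2)" "G4 = f * d2 + f * p * (c2 * z2)"
    and p: "p = - (C * f)" "p1 = p\<^sup>2 + V" and q: "w * q = V * f" "w * q1 = 2 * (V * f) * p - V2"
  shows "- (p1 * z2 * (c1 * G1 + c2 * G2) + p * (d1 * G1 + d2 * G2) +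
      w * z1 * (q1 * (z2 * c2 * c1) + q * (d2 * c1 + d1 * c2))) =
    C * (G1 * G3 + G2 * G4) - V * (c1 * z2 * G1 + c2 * z2 * G2 + c1 * z1 * G4 + c2 * z1 * G3) +
    V2 * (c1 * z1 * c2 * z2)"
proof -
  have "- (p1 * z2 * (c1 * G1 + c2 * G2) + p * (d1 * G1 + d2 * G2) +
      w * z1 * (q1 * (z2 * c2 * c1) + q * (d2 * c1 + d1 * c2))) =
    - (p1 * z2 * (c1 * G1 + c2 * G2) + p * (d1 * G1 + d2 * G2) +
      z1 * ((w * q1) * (z2 * c2 * c1) + (w * q) * (d2 * c1 + d1 * c2)))"
    by (simp add: algebra_simps)
  also have "\<dots> = C * (G1 * G3 + G2 * G4) - V * (c1 * z2 * G1 + c2 * z2 * G2 + c1 * z1 * G4 + c2 * z1 * G3) +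
    V2 * (c1 * z1 * c2 * z2)"
    unfolding q p G by (simp add: algebra_simps power2_eq_square)
  finally show ?thesis .
qed

section \<open>Smoothness and positivity of the metric\<close>

text \<open>Off the origin every root, quotient and power in \<open>h\<close> is a real power of
  \<open>inner w w\<close> or of \<open>A + inner w w powr n\<close>, both positive there, so
  closure under \<open>powr\<close>, sums and products suffices.\<close>

lemma smooth_on_radial_metric:
  assumes "n > 0" "A > 0"
    and g: "\<And>w :: complex ^ 'n::finite. w \<noteq> 0 \<Longrightarrow> h w =
      of_real (slope n A ((norm w)\<^sup>2)) * d +
      of_real (slope n A ((norm w)\<^sup>2) * log_slope n A ((norm w)\<^sup>2)) * (cnj (w $ \<mu>) * w $ \<nu>)"
  shows "smooth_on (- {0}) h"
  unfolding smooth_on_def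
proof
  fix k
  let ?S = "- {0} :: (complex ^ 'n) set"
  have S: "open ?S" by (rule open_Compl[OF closed_singleton])
  have u: "Ck_on k ?S (\<lambda>w. inner w w)"
    by (rule Ck_on_bilinear[OF bounded_bilinear_inner S Ck_on_id[OF S] Ck_on_id[OF S]])
  have pos: "0 < inner w w" if "w \<in> ?S" for w using that by simp
  have U: "0 < A + inner w w powr n" for w :: "complex ^ 'n" using assms by (simp add: add_pos_nonneg)
  note up = Ck_on_powr[OF S pos u]
  note m = Ck_on_bilinear[OF bounded_bilinear_mult S]
  have s: "Ck_on k ?S (\<lambda>w. A + inner w w powr n)"
    by (intro Ck_on_add S Ck_on_const up)
  have F: "Ck_on k ?S (\<lambda>w. (A + inner w w powr n) powr (1 / n) * inner w w powr -1)"
    by (intro m Ck_on_powr[OF S U] s up)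
  have P: "Ck_on k ?S (\<lambda>w. - A * (inner w w powr -1 * (A + inner w w powr n) powr -1))"
    by (intro m Ck_on_powr[OF S U] s up Ck_on_const S)
  have c: "Ck_on k ?S (\<lambda>w. w $ \<nu>)" "Ck_on k ?S (\<lambda>w. cnj (w $ \<mu>))"
    by (intro Ck_on_linear[OF bounded_linear_vec_nth S] Ck_on_linear[OF bounded_linear_cnj S] Ck_on_id S)+
  have "Ck_on k ?S (\<lambda>w. of_real ((A + inner w w powr n) powr (1 / n) * inner w w powr -1) * d +
    of_real (((A + inner w w powr n) powr (1 / n) * inner w w powr -1) *
       (- A * (inner w w powr -1 * (A + inner w w powr n) powr -1))) * (cnj (w $ \<mu>) * w $ \<nu>))"
    by (intro Ck_on_add S m Ck_on_linear[OF bounded_linear_of_real S] F P c Ck_on_const)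
  then show "Ck_on k ?S h"
  proof (rule Ck_on_cong[OF S, rotated])
    fix w :: "complex ^ 'n" assume "w \<in> ?S"
    then have w: "w \<noteq> 0" "0 < inner w w" by auto
    have n: "inner w w powr n = inner w w ^ n" using w by (simp add: powr_realpow)
    have s: "0 < A + inner w w ^ n" using w assms by (simp add: add_pos_pos)
    have "slope n A ((norm w)\<^sup>2) = (A + inner w w powr n) powr (1 / n) * inner w w powr -1"
      unfolding power2_norm_eq_inner slope_eq[OF assms(1,2) w(2)] n using s w assms
      by (simp add: root_powr_inverse powr_minus divide_inverse)
    moreover have "log_slope n A ((norm w)\<^sup>2) = - A * (inner w w powr -1 * (A + inner w w powr n) powr -1)"
      unfolding power2_norm_eq_inner log_slope_def n using s w
      by (simp add: powr_minus divide_inverse)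
    ultimately show "of_real ((A + inner w w powr n) powr (1 / n) * inner w w powr -1) * d +
    of_real (((A + inner w w powr n) powr (1 / n) * inner w w powr -1) *
       (- A * (inner w w powr -1 * (A + inner w w powr n) powr -1))) * (cnj (w $ \<mu>) * w $ \<nu>) = h w"
      unfolding g[OF w(1)] by simp
  qed
qed

text \<open>The quadratic form is \<open>F |v|^2 + F1 |S|^2\<close>, \<open>S\<close> being the
  Hermitian product of v with z. As \<open>F1 \<le> 0\<close>, the Cauchy-Schwarz inequality bounds
  it below by the eigenvalue \<open>F + u F1\<close> times |v|^2.\<close>

lemma radial_metric_pos:
  fixes z v :: "complex ^ 'n::finite" and F F1 :: real
  assumes "F > 0" "F + (norm z)\<^sup>2 * F1 > 0" "F1 \<le> 0" "v \<noteq> 0"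
  shows "0 < Re (\<Sum>\<mu>\<in>UNIV. \<Sum>\<nu>\<in>UNIV. (of_real F * delta \<mu> \<nu> + of_real F1 * (cnj (z $ \<mu>) * z $ \<nu>)) * v $ \<mu> * cnj (v $ \<nu>))"
proof -
  define S where "S = (\<Sum>\<mu>\<in>UNIV. cnj (z $ \<mu>) * v $ \<mu>)"
  have cS: "cnj S = (\<Sum>\<nu>\<in>UNIV. z $ \<nu> * cnj (v $ \<nu>))" unfolding S_def by simp
  have "(\<Sum>\<mu>\<in>UNIV. \<Sum>\<nu>\<in>UNIV. (of_real F * delta \<mu> \<nu> + of_real F1 * (cnj (z $ \<mu>) * z $ \<nu>)) * v $ \<mu> * cnj (v $ \<nu>))
    = (\<Sum>\<mu>\<in>UNIV. \<Sum>\<nu>\<in>UNIV. (of_real F * (v $ \<mu> * (delta \<mu> \<nu> * cnj (v $ \<nu>))) +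
        of_real F1 * ((cnj (z $ \<mu>) * v $ \<mu>) * (z $ \<nu> * cnj (v $ \<nu>)))))"
    by (intro sum.cong refl) (simp add: algebra_simps)
  also have "\<dots> = of_real F * (\<Sum>\<mu>\<in>UNIV. v $ \<mu> * cnj (v $ \<mu>)) + of_real F1 * (S * cnj S)"
    unfolding double_sum_linear sum_distrib_left[symmetric] sum_delta cS[symmetric]
    unfolding sum_distrib_right[symmetric] S_def ..
  also have "\<dots> = of_real (F * (norm v)\<^sup>2 + F1 * (cmod S)\<^sup>2)"
    unfolding sum_vec_mult_cnj unfolding complex_norm_square[symmetric] by simp
  finally have *: "Re (\<Sum>\<mu>\<in>UNIV. \<Sum>\<nu>\<in>UNIV. (of_real F * delta \<mu> \<nu> + of_real F1 * (cnj (z $ \<mu>) * z $ \<nu>)) * v $ \<mu> * cnj (v $ \<nu>))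
     = F * (norm v)\<^sup>2 + F1 * (cmod S)\<^sup>2" by simp
  have "cmod S \<le> (\<Sum>\<mu>\<in>UNIV. \<bar>cmod (z $ \<mu>)\<bar> * \<bar>cmod (v $ \<mu>)\<bar>)"
    unfolding S_def by (rule order_trans[OF norm_sum]) (simp add: norm_mult)
  also have "\<dots> \<le> norm z * norm v" unfolding norm_vec_def by (rule L2_set_mult_ineq)
  finally have "(cmod S)\<^sup>2 \<le> (norm z)\<^sup>2 * (norm v)\<^sup>2"
    unfolding power_mult_distrib[symmetric] by (rule power_mono) simp
  then have "F1 * ((norm z)\<^sup>2 * (norm v)\<^sup>2) \<le> F1 * (cmod S)\<^sup>2" using assms by (simp add: mult_left_mono_neg)
  moreover have "0 < (F + (norm z)\<^sup>2 * F1) * (norm v)\<^sup>2" using assms by simp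
  ultimately show ?thesis unfolding * by (simp add: algebra_simps)
qed

subsection \<open>The Kretschmann scalar\<close>

text \<open>\<open>e\<close> and \<open>h\<close> are the parts of g along the line of z and across
  it. Raising an index turns them into the complementary projections \<open>E\<close> and
  \<open>H\<close>, whatever the two eigenvalues are, so only the coefficients and the ranks 1 and n
  - 1 enter the scalar.\<close>

lemma kretschmann_rank_one:
  fixes z :: "complex ^ 'n::finite" and g :: "complex ^ 'n \<Rightarrow> complex ^ 'n ^ 'n"
  assumes "z \<noteq> 0"
    and g: "\<And>\<mu> \<nu>. g z $ \<mu> $ \<nu> = f * delta \<mu> \<nu> + f1 * (cnj (z $ \<mu>) * z $ \<nu>)"
    and f: "f \<noteq> 0" "f \<in> \<real>" "f1 \<in> \<real>"
    and w: "w = f + of_real ((norm z)\<^sup>2) * f1" "w \<noteq> 0"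
    and e: "\<And>\<mu> \<nu>. e \<mu> \<nu> = w * (cnj (z $ \<mu>) * z $ \<nu>) / of_real ((norm z)\<^sup>2)"
    and h: "\<And>\<mu> \<nu>. h \<mu> \<nu> = g z $ \<mu> $ \<nu> - e \<mu> \<nu>"
    and R: "\<And>\<mu> \<nu> \<alpha> \<beta>. curvature g z \<mu> \<nu> \<alpha> \<beta> =
      of_real p * tensor_form 1 (of_real q) (of_real r) h e \<mu> \<nu> \<alpha> \<beta> +
      of_real p * tensor_form 1 (of_real q) (of_real r) h e \<alpha> \<nu> \<mu> \<beta>"
  shows "kretschmann g z = of_real (2 * p\<^sup>2 * (real CARD('n) * (real CARD('n) - 1) +
    2 * q\<^sup>2 * (real CARD('n) - 1) + 2 * r\<^sup>2))"
proof -
  let ?u = "complex_of_real ((norm z)\<^sup>2)"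
  define E H where "E \<mu> \<nu> = cnj (z $ \<mu>) * z $ \<nu> / ?u" and "H \<mu> \<nu> = delta \<mu> \<nu> - E \<mu> \<nu>" for \<mu> \<nu>
  let ?I = "g_inv g z"
  have u: "?u \<noteq> 0" using \<open>z \<noteq> 0\<close> by simp
  have zz: "(\<Sum>\<nu>\<in>UNIV. z $ \<nu> * cnj (z $ \<nu>)) = ?u" by (rule sum_vec_mult_cnj)
  have c: "(- f1 / w) * (f + ?u * f1) = - f1" using w by simp
  note I = g_inv_rank_one[where g = g and z = z, OF g f(1) c]
  have gI: "(\<Sum>\<nu>\<in>UNIV. g z $ \<mu> $ \<nu> * ?I \<nu> \<kappa>) = delta \<mu> \<kappa>" for \<mu> \<kappa>
    unfolding I g by (rule rank_one_inverse[OF f(1) c])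
  \<comment> \<open>The inverse has eigenvalue \<open>1 / w\<close> on z, which cancels the
    \<open>w\<close> in \<open>e\<close>.\<close>
  have zI: "(\<Sum>\<nu>\<in>UNIV. z $ \<nu> * ?I \<nu> \<kappa>) = z $ \<kappa> / w" for \<kappa>
  proof -
    have "(\<Sum>\<nu>\<in>UNIV. z $ \<nu> * ?I \<nu> \<kappa>) = (1 / f - f1 / w / f * ?u) * z $ \<kappa>"
      unfolding I rank_one_contract zz by (simp add: algebra_simps)
    also have "1 / f - f1 / w / f * ?u = (w - f1 * ?u) / (f * w)"
      using f(1) w(2) by (simp add: field_simps)
    also have "\<dots> = 1 / w" using f(1) by (simp add: w(1))
    finally show ?thesis by simp
  qed
  have eI: "(\<Sum>\<nu>\<in>UNIV. e \<mu> \<nu> * ?I \<nu> \<kappa>) = E \<mu> \<kappa>" for \<mu> \<kappa>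
  proof -
    have "(\<Sum>\<nu>\<in>UNIV. e \<mu> \<nu> * ?I \<nu> \<kappa>) = (\<Sum>\<nu>\<in>UNIV. (w * cnj (z $ \<mu>) / ?u) * (z $ \<nu> * ?I \<nu> \<kappa>))"
      unfolding e by (intro sum.cong refl) simp
    also have "\<dots> = E \<mu> \<kappa>"
      unfolding sum_distrib_left[symmetric] zI E_def using w(2) by simp
    finally show ?thesis .
  qed
  have hI: "(\<Sum>\<nu>\<in>UNIV. h \<mu> \<nu> * ?I \<nu> \<kappa>) = H \<mu> \<kappa>" for \<mu> \<kappa>
    unfolding h left_diff_distrib sum_subtractf gI eI H_def ..
  have EE: "(\<Sum>\<nu>\<in>UNIV. E \<mu> \<nu> * E \<nu> \<kappa>) = E \<mu> \<kappa>" for \<mu> \<kappa>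
  proof -
    have "(\<Sum>\<nu>\<in>UNIV. E \<mu> \<nu> * E \<nu> \<kappa>) =
        (\<Sum>\<nu>\<in>UNIV. (cnj (z $ \<mu>) * z $ \<kappa> / (?u * ?u)) * (z $ \<nu> * cnj (z $ \<nu>)))"
      by (intro sum.cong refl) (simp add: E_def)
    also have "\<dots> = E \<mu> \<kappa>" unfolding sum_distrib_left[symmetric] zz E_def
      using u by (simp del: of_real_power)
    finally show ?thesis .
  qed
  have HE: "(\<Sum>\<nu>\<in>UNIV. H \<mu> \<nu> * E \<nu> \<kappa>) = 0" "(\<Sum>\<nu>\<in>UNIV. E \<mu> \<nu> * H \<nu> \<kappa>) = 0"
    "(\<Sum>\<nu>\<in>UNIV. H \<mu> \<nu> * H \<nu> \<kappa>) = H \<mu> \<kappa>" for \<mu> \<kappa>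
    unfolding H_def left_diff_distrib right_diff_distrib sum_subtractf sum_delta EE by simp_all
  have trE: "(\<Sum>\<mu>\<in>UNIV. E \<mu> \<mu>) = 1"
    unfolding E_def sum_divide_distrib[symmetric] using zz u by (simp add: mult.commute)
  have trH: "(\<Sum>\<mu>\<in>UNIV. H \<mu> \<mu>) = of_nat CARD('n) - 1"
    unfolding H_def sum_subtractf trE by (simp add: delta_def)
  let ?B = "tensor_form 1 (of_real q) (of_real r)" and ?p = "complex_of_real p"
  define X where "X \<mu> \<nu> \<alpha> \<beta> = ?p * ?B H E \<mu> \<nu> \<alpha> \<beta> + ?p * ?B H E \<alpha> \<nu> \<mu> \<beta>" for \<mu> \<nu> \<alpha> \<beta>
  have ce: "cnj (e \<mu> \<nu>) = e \<nu> \<mu>" for \<mu> \<nu>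
    unfolding e using f(2,3) by (simp add: w(1) Reals_cnj_iff mult_ac)
  have ch: "cnj (h \<mu> \<nu>) = h \<nu> \<mu>" for \<mu> \<nu>
    unfolding h complex_cnj_diff ce g using f(2,3)
    by (simp add: Reals_cnj_iff mult_ac delta_def)
  \<comment> \<open>\<open>e\<close> and \<open>h\<close> are Hermitian and the coefficients real,
    so conjugation only exchanges the indices within each pair. The conjugate thus contracts to the
    same \<open>X\<close>.\<close>
  have cR: "cnj (curvature g z \<mu> \<nu> \<alpha> \<beta>) = ?p * ?B h e \<nu> \<mu> \<beta> \<alpha> + ?p * ?B h e \<beta> \<mu> \<nu> \<alpha>"
    for \<mu> \<nu> \<alpha> \<beta>
    unfolding R tensor_form_def by (simp add: ce ch mult_ac)
  note BC = tensor_form_contract[where A = h and B = e and A' = H and B' = E and C = ?I, OF hI eI]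
  have 1: "(\<Sum>\<nu>\<in>UNIV. \<Sum>\<beta>\<in>UNIV. curvature g z \<mu> \<nu> \<alpha> \<beta> * (?I \<nu> \<kappa> * ?I \<beta> \<tau>)) = X \<mu> \<kappa> \<alpha> \<tau>" for \<mu> \<alpha> \<kappa> \<tau>
    unfolding R distrib_right mult.assoc double_sum_linear BC X_def ..
  have 2: "(\<Sum>\<mu>\<in>UNIV. \<Sum>\<alpha>\<in>UNIV. cnj (curvature g z \<mu> \<nu> \<alpha> \<beta>) * (?I \<mu> \<kappa> * ?I \<alpha> \<tau>)) = X \<nu> \<kappa> \<beta> \<tau>" for \<nu> \<beta> \<kappa> \<tau>
    unfolding cR distrib_right mult.assoc double_sum_linear BC X_def ..
  have X: "X \<mu> \<nu> \<alpha> \<beta> = tensor_form ?p (?p * of_real q) (?p * of_real r) H E \<mu> \<nu> \<alpha> \<beta> +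
      tensor_form ?p (?p * of_real q) (?p * of_real r) H E \<alpha> \<nu> \<mu> \<beta>" for \<mu> \<nu> \<alpha> \<beta>
    unfolding X_def tensor_form_def by (simp add: algebra_simps)
  have "kretschmann g z = 2 * (?p\<^sup>2 * ((of_nat CARD('n) - 1)\<^sup>2 + (of_nat CARD('n) - 1)) +
      2 * (?p * of_real q)\<^sup>2 * (of_nat CARD('n) - 1) * 1 + (?p * of_real r)\<^sup>2 * (1\<^sup>2 + 1))"
    unfolding kretschmann_of_contractions[OF 1 2]
    by (rule tensor_form_symmetrized_square_trace[OF HE(3) EE HE(1,2) trH trE X])
  then show ?thesis by (simp add: algebra_simps power2_eq_square)
qed

section \<open>The metric with the given profile\<close>

theorem proposition6:
  fixes n :: nat and a :: real
    and u :: "complex ^ 'n::finite \<Rightarrow> real"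
    and g :: "complex ^ 'n \<Rightarrow> complex ^ 'n ^ 'n"
  assumes n: "n = CARD('n)" "n \<ge> 2"
    and a: "a > 0"
    and u: "\<And>z. u z = (norm z)\<^sup>2"
    and g: "\<And>z \<mu> \<nu>. z \<noteq> 0 \<Longrightarrow>
      g z $ \<mu> $ \<nu> =
        complex_of_real (root n (1 + a ^ n / u z ^ n)) *
        (delta \<mu> \<nu> - complex_of_real (a ^ n / (a ^ n + u z ^ n)) *
           (cnj (z $ \<mu>) * z $ \<nu> / complex_of_real (u z)))"
  shows "kahler_metric_on (- {0}) g \<and>
    (\<forall>z \<kappa> \<mu> \<alpha>. z \<noteq> 0 \<longrightarrow>
      christoffel g z \<kappa> \<mu> \<alpha> =
        - complex_of_real (a ^ n / (u z * (a ^ n + u z ^ n))) *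
        (cnj (z $ \<mu>) * delta \<kappa> \<alpha> + cnj (z $ \<alpha>) * delta \<kappa> \<mu>
         - of_nat (n + 1) * (cnj (z $ \<alpha>) * cnj (z $ \<mu>) / complex_of_real (u z)) * z $ \<kappa>)) \<and>
    (\<forall>z \<mu> \<nu> \<alpha> \<beta>. z \<noteq> 0 \<longrightarrow>
      curvature g z \<mu> \<nu> \<alpha> \<beta> =
        complex_of_real (a ^ n / (a ^ n + u z ^ n) powr (real (n + 1) / real n)) *
        (g z $ \<alpha> $ \<nu> * g z $ \<mu> $ \<beta> + g z $ \<mu> $ \<nu> * g z $ \<alpha> $ \<beta>
         - of_nat (n + 1) * complex_of_real ((u z / root n (a ^ n + u z ^ n)) ^ (n - 1)) *
           (cnj (z $ \<mu>) * z $ \<beta> / complex_of_real (u z) * g z $ \<alpha> $ \<nu>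
            + cnj (z $ \<alpha>) * z $ \<beta> / complex_of_real (u z) * g z $ \<mu> $ \<nu>
            + cnj (z $ \<mu>) * z $ \<nu> / complex_of_real (u z) * g z $ \<alpha> $ \<beta>
            + cnj (z $ \<alpha>) * z $ \<nu> / complex_of_real (u z) * g z $ \<mu> $ \<beta>)
         + of_nat ((n + 1) * (n + 2)) *
           complex_of_real ((u z / root n (a ^ n + u z ^ n)) ^ (2 * n - 2)) *
           (cnj (z $ \<mu>) * z $ \<nu> * cnj (z $ \<alpha>) * z $ \<beta> / complex_of_real ((u z)\<^sup>2)))) \<and>
    (\<forall>z. z \<noteq> 0 \<longrightarrow>
      kretschmann g z =
        complex_of_real (a ^ (2 * n) / (a ^ n + u z ^ n) powr (2 * (real (n + 1) / real n)) *
          (real n * (real n + 2) * ((real n)\<^sup>2 - 1)))) \<and>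
    (n = 2 \<longrightarrow> (\<forall>z. z \<noteq> 0 \<longrightarrow>
      kretschmann g z = complex_of_real (24 * a ^ 4 / (a\<^sup>2 + (u z)\<^sup>2) ^ 3)))"
proof -
  define A where "A = a ^ n"
  define N where "N = real n"
  have n0: "n > 0" using n(2) by simp
  have A: "A > 0" using a by (simp add: A_def)
  let ?F = "slope n A" and ?p = "log_slope n A" and ?p1 = "log_slope' n A"
  let ?F1 = "\<lambda>x. ?F x * ?p x" and ?q = "\<lambda>x. - (N + 1) * ?p x / x"
  have u0: "u z > 0" if "z \<noteq> 0" for z using that by (simp add: u)
  have G: "g z $ \<mu> $ \<nu> = of_real (?F ((norm z)\<^sup>2)) * delta \<mu> \<nu> +
      of_real (?F1 ((norm z)\<^sup>2)) * (cnj (z $ \<mu>) * z $ \<nu>)" if "z \<noteq> 0" for z \<mu> \<nu>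
    unfolding g[OF that] slope_def log_slope_def u A_def
    by (simp add: algebra_simps)
  have DF: "(?F has_real_derivative ?F1 ((norm z)\<^sup>2)) (at ((norm z)\<^sup>2))"
    and DF1: "(?F1 has_real_derivative ?F1 ((norm z)\<^sup>2) * ?p ((norm z)\<^sup>2) +
        ?p1 ((norm z)\<^sup>2) * ?F ((norm z)\<^sup>2)) (at ((norm z)\<^sup>2))"
    and Dp: "(?p has_real_derivative ?p1 ((norm z)\<^sup>2)) (at ((norm z)\<^sup>2))"
    and Dq: "(?q has_real_derivative - (N + 1) * (?p1 ((norm z)\<^sup>2) / (norm z)\<^sup>2 -
        ?p ((norm z)\<^sup>2) / ((norm z)\<^sup>2)\<^sup>2)) (at ((norm z)\<^sup>2))" if "z \<noteq> 0" for z :: "complex ^ 'n"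
  proof -
    define x where "x = (norm z)\<^sup>2"
    have x: "x > 0" using that by (simp add: x_def)
    note F = DERIV_slope[OF n0 A x] and p = DERIV_log_slope[OF n0 A x]
    have "(?q has_real_derivative ((- (N + 1) * ?p1 x) * x - (- (N + 1) * ?p x) * 1) / (x * x)) (at x)"
      by (intro DERIV_divide DERIV_cmult p DERIV_ident) (use x in simp)
    moreover have "((- (N + 1) * ?p1 x) * x - (- (N + 1) * ?p x) * 1) / (x * x) =
        - (N + 1) * (?p1 x / x - ?p x / x\<^sup>2)"
      using x by (simp add: field_simps power2_eq_square)
    ultimately show "(?q has_real_derivative - (N + 1) * (?p1 ((norm z)\<^sup>2) / (norm z)\<^sup>2 -
        ?p ((norm z)\<^sup>2) / ((norm z)\<^sup>2)\<^sup>2)) (at ((norm z)\<^sup>2))" by (simp only: x_def)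
    show "(?F has_real_derivative ?F1 ((norm z)\<^sup>2)) (at ((norm z)\<^sup>2))"
      "(?p has_real_derivative ?p1 ((norm z)\<^sup>2)) (at ((norm z)\<^sup>2))"
      using F p by (simp_all only: x_def)
    show "(?F1 has_real_derivative ?F1 ((norm z)\<^sup>2) * ?p ((norm z)\<^sup>2) +
        ?p1 ((norm z)\<^sup>2) * ?F ((norm z)\<^sup>2)) (at ((norm z)\<^sup>2))"
      using DERIV_mult[OF F p] by (simp only: x_def)
  qed
  have \<Gamma>: "christoffel g z \<kappa> \<mu> \<alpha> =
      of_real (?p ((norm z)\<^sup>2)) * (cnj (z $ \<mu>) * delta \<kappa> \<alpha> + cnj (z $ \<alpha>) * delta \<kappa> \<mu>) +
      of_real (?q ((norm z)\<^sup>2)) * (cnj (z $ \<alpha>) * cnj (z $ \<mu>) * z $ \<kappa>)"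
    if "z \<noteq> 0" for z \<kappa> \<mu> \<alpha>
  proof -
    define x where "x = (norm z)\<^sup>2"
    have x: "x > 0" using that by (simp add: x_def)
    have s: "A + x ^ n > 0" using A x by (simp add: add_pos_pos)
    have F: "?F x > 0" by (rule slope_pos[OF n0 A x])
    have w: "?F x + x * ?F1 x = ?F x * (x ^ n / (A + x ^ n))"
      unfolding slope_root_power(2)[OF n0 A x, symmetric] by (simp add: algebra_simps)
    \<comment> \<open>The Sherman-Morrison constant is \<open>- p / (1 + x p)\<close> for
      \<open>p = log_slope n A x\<close>, and \<open>1 + x p = x ^ n / (A + x ^ n)\<close>.\<close>
    have c: "A / (x * x ^ n) * (?F x + x * ?F1 x) = - ?F1 x"
      unfolding w unfolding log_slope_def using x s by simp
    \<comment> \<open>The quotient \<open>F'' / F\<close> is \<open>p\<^sup>2 + p'\<close>.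
      Multiplied by \<open>1 + c x\<close>, it splits into the term with \<open>N + 1\<close> and a
      term in \<open>A * A\<close> that cancels against \<open>2 c p\<close>.\<close>
    have q: "?q x = (?F1 x * ?p x + ?p1 x * ?F x) / ?F x * (1 + A / (x * x ^ n) * x) +
        2 * (A / (x * x ^ n)) * ?p x"
    proof -
      define y where "y = x ^ n"
      have y: "y > 0" "A + y > 0" using x A by (auto simp: y_def add_pos_pos)
      have "(?F1 x * ?p x + ?p1 x * ?F x) / ?F x = (?p x)\<^sup>2 + ?p1 x"
        using F by (simp add: field_simps power2_eq_square)
      also have "\<dots> = A * (2 * A + (N + 1) * y) / (x * (A + y))\<^sup>2"
        unfolding log_slope_def log_slope'_def y_def[symmetric] N_def
        by (simp add: power_divide add_divide_distrib[symmetric] power2_eq_square algebra_simps)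
      finally have 1: "(?F1 x * ?p x + ?p1 x * ?F x) / ?F x = A * (2 * A + (N + 1) * y) / (x * (A + y))\<^sup>2" .
      have 2: "1 + A / (x * y) * x = (A + y) / y" using x y by (simp add: field_simps)
      have "A * (2 * A + (N + 1) * y) / (x * (A + y))\<^sup>2 * ((A + y) / y) =
          A * (2 * A + (N + 1) * y) / (x\<^sup>2 * (A + y) * y)"
        using y by (simp add: power2_eq_square)
      also have "\<dots> = (N + 1) * A / (x\<^sup>2 * (A + y)) + 2 * A * A / (x\<^sup>2 * (A + y) * y)"
      proof -
        have "A * (2 * A + (N + 1) * y) = (N + 1) * A * y + 2 * A * A" by (simp add: algebra_simps)
        then show ?thesis using y by (simp only: add_divide_distrib) simp
      qed
      finally have 3: "A * (2 * A + (N + 1) * y) / (x * (A + y))\<^sup>2 * ((A + y) / y) = \<dots>" .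
      have 4: "- M * (- A / (x * (A + y))) / x = M * A / (x\<^sup>2 * (A + y))" for M
        by (simp add: power2_eq_square mult_ac)
      have 5: "2 * (A / (x * y)) * (- A / (x * (A + y))) = - (2 * A * A / (x\<^sup>2 * (A + y) * y))"
        by (simp add: power2_eq_square mult_ac)
      show ?thesis
        unfolding y_def[symmetric] 1 2 3 unfolding log_slope_def y_def[symmetric] 4 5 by simp
    qed
    show ?thesis
      by (rule christoffel_radial_metric[where F = ?F and ?F1.0 = ?F1, OF G DF[OF that] DF1[OF that] that
            _ c[unfolded x_def] _ q[unfolded x_def]])
        (use F in \<open>simp_all add: x_def\<close>)
  qed
  have kahler: "kahler_metric_on (- {0}) g"
    unfolding kahler_metric_on_def
  proof (intro conjI allI ballI impI)
    show "open (- {0 :: complex ^ 'n})" by (rule open_Compl[OF closed_singleton])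
    show "smooth_on (- {0}) (\<lambda>z. g z $ \<mu> $ \<nu>)" for \<mu> \<nu>
      by (rule smooth_on_radial_metric[OF n0 A G])
    fix z :: "complex ^ 'n" assume "z \<in> - {0}"
    then have z: "z \<noteq> 0" by simp
    have x: "(norm z)\<^sup>2 > 0" using z by simp
    show "g z $ \<nu> $ \<mu> = cnj (g z $ \<mu> $ \<nu>)" for \<mu> \<nu>
      unfolding G[OF z] by (simp add: delta_def mult_ac)
    show "d_z \<alpha> (\<lambda>w. g w $ \<mu> $ \<nu>) z = d_z \<mu> (\<lambda>w. g w $ \<alpha> $ \<nu>) z" for \<alpha> \<mu> \<nu>
    proof -
      note D = d_z_radial_metric[where F = ?F and ?F1.0 = ?F1, OF _ DF[OF z] DF1[OF z] z]
      show ?thesis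
        by (subst D[where g = g and \<alpha> = \<alpha> and \<mu> = \<mu>, OF G], assumption,
            subst D[where g = g and \<alpha> = \<mu> and \<mu> = \<alpha>, OF G], assumption)
          (simp add: algebra_simps)
    qed
    show "0 < Re (\<Sum>\<mu>\<in>UNIV. \<Sum>\<nu>\<in>UNIV. g z $ \<mu> $ \<nu> * v $ \<mu> * cnj (v $ \<nu>))" if "v \<noteq> 0" for v
      unfolding G[OF z]
    proof (rule radial_metric_pos[OF slope_pos[OF n0 A x] _ _ that])
      have "0 < slope n A ((norm z)\<^sup>2) * (1 + (norm z)\<^sup>2 * log_slope n A ((norm z)\<^sup>2))"
        unfolding slope_root_power(2)[OF n0 A x] using slope_pos[OF n0 A x] A x
        by (simp add: add_pos_pos)
      then show "0 < ?F ((norm z)\<^sup>2) + (norm z)\<^sup>2 * ?F1 ((norm z)\<^sup>2)" by (simp add: algebra_simps)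
      show "?F1 ((norm z)\<^sup>2) \<le> 0"
        using slope_pos[OF n0 A x] A x
        by (intro mult_nonneg_nonpos) (auto simp: log_slope_def add_nonneg_nonneg)
    qed
  qed
  define C where "C z = A / (A + u z ^ n) powr (real (n + 1) / real n)" for z
  define W where "W z = (u z / root n (A + u z ^ n)) ^ (n - 1)" for z
  have W: "W z = ?F ((norm z)\<^sup>2) * (1 + (norm z)\<^sup>2 * ?p ((norm z)\<^sup>2))" "W z > 0"
    if "z \<noteq> 0" for z
  proof -
    show "W z = ?F ((norm z)\<^sup>2) * (1 + (norm z)\<^sup>2 * ?p ((norm z)\<^sup>2))"
      using slope_root_power(1)[OF n0 A u0[OF that]] by (simp only: W_def u)
    show "W z > 0"
      unfolding W_def using u0[OF that] A n0
      by (intro zero_less_power divide_pos_pos real_root_gt_zero add_pos_pos) auto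
  qed
  \<comment> \<open>All scalars are gathered into one real coefficient per group of terms; the
    second and third are the \<open>V\<close> and \<open>V2\<close> of
    \<open>curvature_assembly\<close>.\<close>
  have R: "curvature g z \<mu> \<nu> \<alpha> \<beta> =
      of_real (C z) * (g z $ \<alpha> $ \<nu> * g z $ \<mu> $ \<beta> + g z $ \<mu> $ \<nu> * g z $ \<alpha> $ \<beta>) -
      of_real (C z * (N + 1) * W z / u z) *
         (cnj (z $ \<mu>) * z $ \<beta> * g z $ \<alpha> $ \<nu> + cnj (z $ \<alpha>) * z $ \<beta> * g z $ \<mu> $ \<nu> +
          cnj (z $ \<mu>) * z $ \<nu> * g z $ \<alpha> $ \<beta> + cnj (z $ \<alpha>) * z $ \<nu> * g z $ \<mu> $ \<beta>) +
      of_real (C z * ((N + 1) * (N + 2)) * (W z)\<^sup>2 / (u z)\<^sup>2) *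
         (cnj (z $ \<mu>) * z $ \<nu> * cnj (z $ \<alpha>) * z $ \<beta>)"
    if z: "z \<noteq> 0" for z \<mu> \<nu> \<alpha> \<beta>
  proof -
    note co = curvature_coefficients[OF n0 A u0[OF z], folded C_def W_def N_def]
    let ?x = "(norm z)\<^sup>2"
    \<comment> \<open>The eigenvalue from lowering the index is \<open>W z\<close>, which brings
      this factor into the curvature formula.\<close>
    have w: "of_real (?F ?x) + of_real ?x * of_real (?F1 ?x) = complex_of_real (W z)"
      unfolding W(1)[OF z] by (simp add: algebra_simps)
    note cur = curvature_radial_metric[where g = g and z = z and p = ?p and q = ?q,
        OF G[OF z] \<Gamma> Dp[OF z] Dq[OF z] z, unfolded w]
    show ?thesis
    proof (rule trans[OF cur curvature_assembly])
      show "g z $ \<mu> $ \<beta> = of_real (?F ?x) * delta \<mu> \<beta> + of_real (?F ?x) * of_real (?p ?x) * (cnj (z $ \<mu>) * z $ \<beta>)"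
        "g z $ \<alpha> $ \<beta> = of_real (?F ?x) * delta \<alpha> \<beta> + of_real (?F ?x) * of_real (?p ?x) * (cnj (z $ \<alpha>) * z $ \<beta>)"
        unfolding G[OF z] by simp_all
      show "complex_of_real (?p ?x) = - (of_real (C z) * of_real (?F ?x))"
        using co(1) unfolding u by (metis of_real_minus of_real_mult)
      show "complex_of_real (?p1 ?x) = (of_real (?p ?x))\<^sup>2 + of_real (C z * (N + 1) * W z / u z)"
        using co(2) unfolding u of_real_power[symmetric] of_real_add[symmetric] by (rule arg_cong)
      show "complex_of_real (W z) * of_real (?q ?x) = of_real (C z * (N + 1) * W z / u z) * of_real (?F ?x)"
        using co(3) unfolding u of_real_mult[symmetric] by (rule arg_cong)
      show "complex_of_real (W z) * of_real (- (N + 1) * (?p1 ?x / ?x - ?p ?x / ?x\<^sup>2)) =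
          2 * (of_real (C z * (N + 1) * W z / u z) * of_real (?F ?x)) * of_real (?p ?x) -
          of_real (C z * ((N + 1) * (N + 2)) * (W z)\<^sup>2 / (u z)\<^sup>2)"
      proof -
        have "complex_of_real (W z * (- (N + 1) * (?p1 ?x / ?x - ?p ?x / ?x\<^sup>2))) =
          of_real (2 * (C z * (N + 1) * W z / u z * ?F ?x) * ?p ?x -
            C z * ((N + 1) * (N + 2)) * (W z)\<^sup>2 / (u z)\<^sup>2)"
          using co(4) unfolding u by (rule arg_cong)
        then show ?thesis by (simp only: of_real_mult of_real_diff of_real_numeral)
      qed
    qed
  qed
  have K: "kretschmann g z = of_real ((C z)\<^sup>2 * (N * (N + 2) * (N\<^sup>2 - 1)))" if z: "z \<noteq> 0" for z
  proof -
    let ?x = "(norm z)\<^sup>2"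
    define e where "e \<mu> \<nu> = of_real (W z) * (cnj (z $ \<mu>) * z $ \<nu>) / of_real ((norm z)\<^sup>2)" for \<mu> \<nu>
    define h where "h \<mu> \<nu> = g z $ \<mu> $ \<nu> - e \<mu> \<nu>" for \<mu> \<nu>
    \<comment> \<open>Since \<open>e\<close> is \<open>W z / u z\<close> times the rank-one matrix,
      R is the symmetrization of \<open>g \<otimes> g - (N + 1) (e \<otimes> g + g \<otimes> e) + (N
      + 1) (N + 2) / 2 e \<otimes> e\<close>. Inserting \<open>g = h + e\<close> gives the mixed
      coefficient \<open>1 - (N + 1)\<close> and the last one
      \<open>1 - 2 (N + 1) + (N + 1) (N + 2) / 2\<close>.\<close>
    have Rb: "curvature g z \<mu> \<nu> \<alpha> \<beta> =
      of_real (C z) * tensor_form 1 (of_real (- N)) (of_real (N * (N - 1) / 2)) h e \<mu> \<nu> \<alpha> \<beta> +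
      of_real (C z) * tensor_form 1 (of_real (- N)) (of_real (N * (N - 1) / 2)) h e \<alpha> \<nu> \<mu> \<beta>" for \<mu> \<nu> \<alpha> \<beta>
    proof -
      define k where "k = complex_of_real (W z / u z)"
      define c where "c = complex_of_real (C z)"
      define m where "m = complex_of_real N"
      have e: "e \<mu> \<nu> = k * (cnj (z $ \<mu>) * z $ \<nu>)" for \<mu> \<nu> by (simp add: e_def k_def u)
      have 1: "of_real (C z * (N + 1) * W z / u z) = c * (m + 1) * k"
        "of_real (C z * ((N + 1) * (N + 2)) * (W z)\<^sup>2 / (u z)\<^sup>2) = c * ((m + 1) * (m + 2)) * k\<^sup>2"
        "complex_of_real (- N) = - m" "complex_of_real (N * (N - 1) / 2) = m * (m - 1) / 2"
        by (simp_all add: c_def m_def k_def power_divide)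
      show ?thesis unfolding R[OF z] 1 c_def[symmetric] tensor_form_def h_def e
        by (simp add: field_simps power2_eq_square)
    qed
    have "kretschmann g z = of_real (2 * (C z)\<^sup>2 * (real CARD('n) * (real CARD('n) - 1) +
        2 * (- N)\<^sup>2 * (real CARD('n) - 1) + 2 * (N * (N - 1) / 2)\<^sup>2))"
    proof (rule kretschmann_rank_one[OF z G[OF z] _ _ _ _ _ e_def h_def Rb])
      show "complex_of_real (W z) = of_real (?F ?x) + of_real ?x * of_real (?F1 ?x)"
        unfolding W(1)[OF z] by (simp add: algebra_simps)
      show "complex_of_real (?F ?x) \<noteq> 0" using slope_pos[OF n0 A u0[OF z]] by (simp add: u)
      show "complex_of_real (W z) \<noteq> 0" using W(2)[OF z] by simp
    qed simp_all
    \<comment> \<open>Taking out \<open>N (N - 1)\<close> leaves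
      \<open>2 + 4 N + N (N - 1) = (N + 1) (N + 2)\<close>.\<close>
    also have "2 * (C z)\<^sup>2 * (real CARD('n) * (real CARD('n) - 1) +
        2 * (- N)\<^sup>2 * (real CARD('n) - 1) + 2 * (N * (N - 1) / 2)\<^sup>2) =
       (C z)\<^sup>2 * (N * (N + 2) * (N\<^sup>2 - 1))"
      unfolding n(1)[symmetric] N_def[symmetric] by (simp add: field_simps power2_eq_square)
    finally show ?thesis .
  qed
  have C2: "(C z)\<^sup>2 = a ^ (2 * n) / (a ^ n + u z ^ n) powr (2 * (real (n + 1) / real n))" for z
  proof -
    have "(s powr e)\<^sup>2 = s powr (2 * e)" for s e :: real
      by (simp only: power2_eq_square mult_2 powr_add)
    then show ?thesis
      unfolding C_def A_def power_divide by (simp only: power_mult[symmetric] mult.commute)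
  qed
  show ?thesis
  proof (intro conjI allI impI kahler)
    fix z :: "complex ^ 'n" and \<kappa> \<mu> \<alpha> assume z: "z \<noteq> 0"
    show "christoffel g z \<kappa> \<mu> \<alpha> =
        - complex_of_real (a ^ n / (u z * (a ^ n + u z ^ n))) *
        (cnj (z $ \<mu>) * delta \<kappa> \<alpha> + cnj (z $ \<alpha>) * delta \<kappa> \<mu>
         - of_nat (n + 1) * (cnj (z $ \<alpha>) * cnj (z $ \<mu>) / complex_of_real (u z)) * z $ \<kappa>)"
    proof -
      have "a ^ n / (u z * (a ^ n + u z ^ n)) = - ?p (u z)" by (simp add: log_slope_def A_def)
      then show ?thesis
        unfolding \<Gamma>[OF z] u[symmetric] N_def by (simp add: divide_inverse algebra_simps)
    qed
  next
    fix z :: "complex ^ 'n" and \<mu> \<nu> \<alpha> \<beta> assume z: "z \<noteq> 0"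
    have "2 * n - 2 = (n - 1) * 2" by simp
    then have "(u z / root n (A + u z ^ n)) ^ (2 * n - 2) = (W z)\<^sup>2"
      unfolding W_def power_mult[symmetric] by (simp only:)
    then show "curvature g z \<mu> \<nu> \<alpha> \<beta> =
        complex_of_real (a ^ n / (a ^ n + u z ^ n) powr (real (n + 1) / real n)) *
        (g z $ \<alpha> $ \<nu> * g z $ \<mu> $ \<beta> + g z $ \<mu> $ \<nu> * g z $ \<alpha> $ \<beta>
         - of_nat (n + 1) * complex_of_real ((u z / root n (a ^ n + u z ^ n)) ^ (n - 1)) *
           (cnj (z $ \<mu>) * z $ \<beta> / complex_of_real (u z) * g z $ \<alpha> $ \<nu>
            + cnj (z $ \<alpha>) * z $ \<beta> / complex_of_real (u z) * g z $ \<mu> $ \<nu>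
            + cnj (z $ \<mu>) * z $ \<nu> / complex_of_real (u z) * g z $ \<alpha> $ \<beta>
            + cnj (z $ \<alpha>) * z $ \<nu> / complex_of_real (u z) * g z $ \<mu> $ \<beta>)
         + of_nat ((n + 1) * (n + 2)) *
           complex_of_real ((u z / root n (a ^ n + u z ^ n)) ^ (2 * n - 2)) *
           (cnj (z $ \<mu>) * z $ \<nu> * cnj (z $ \<alpha>) * z $ \<beta> / complex_of_real ((u z)\<^sup>2)))"
      unfolding A_def[symmetric] C_def[symmetric] W_def[symmetric] R[OF z] N_def
      by (simp add: divide_inverse algebra_simps)
  next
    fix z :: "complex ^ 'n" assume z: "z \<noteq> 0"
    show "kretschmann g z =
        complex_of_real (a ^ (2 * n) / (a ^ n + u z ^ n) powr (2 * (real (n + 1) / real n)) *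
          (real n * (real n + 2) * ((real n)\<^sup>2 - 1)))"
      unfolding K[OF z] C2 N_def ..
  next
    fix z :: "complex ^ 'n" assume "n = 2" and z: "z \<noteq> 0"
    have s: "a\<^sup>2 + (u z)\<^sup>2 > 0" using a by (simp add: add_pos_nonneg)
    have "(a\<^sup>2 + (u z)\<^sup>2) powr 3 = (a\<^sup>2 + (u z)\<^sup>2) ^ 3" using powr_realpow[OF s, of 3] by simp
    then show "kretschmann g z = complex_of_real (24 * a ^ 4 / (a\<^sup>2 + (u z)\<^sup>2) ^ 3)"
      unfolding K[OF z] C2 N_def \<open>n = 2\<close> by simp
  qed
qed

end
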